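(* Let $H\sim W_m(n_H,\ \sigma^2 I+\lambda_H v v^T)$ with $v\in\mathbb{R}^m$, $\|v\|=1$, $\lambda_H>0$, and let $\ell_1$ be the largest eigenvalue of $H$. Then, with $(m,n_H,\lambda_H)$ fixed, as $\sigma\to 0$, $$\ell_1=(\lambda_H+\sigma^2)\,\chi^2_{n_H}+\chi^2_{m-1}\,\sigma^2+\frac{\chi^2_{m-1}\,\chi^2_{n_H-1}}{(\lambda_H+\sigma^2)\,\chi^2_{n_H}}\,\sigma^4+o_p(\sigma^4),$$ where the three variates $\chi^2_{n_H}$, $\chi^2_{m-1}$ and $\chi^2_{n_H-1}$ are independent (and each symbol denotes the same random variable at every occurrence).
   Context: $W_m(n,\Sigma)$ denotes the central Wishart distribution: the law of $\sum_{i=1}^n z_iz_i^T$ with $z_1,\dots,z_n$ i.i.d. $N_m(0,\Sigma)$. $\chi^2_k$ denotes a random variable with the central chi-squared distribution with $k$ degrees of freedom ($\chi^2_0\equiv 0$). The displayed equality is a stochastic representation: for each $\sigma>0$ the matrix $H$ and independent chi-squared variates with the stated degrees of freedom can be realized on a common probability space so that the equality holds, and $o_p(\sigma^4)$ denotes a random remainder which, divided by $\sigma^4$, tends to $0$ in probability as $\sigma\to0$. *)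

theory Defs
  imports "HOL-Probability.Probability"
begin

definition outer :: "real^'m \<Rightarrow> real^'m^'m" where
  "outer v = (\<chi> i j. v $ i * v $ j)"

definition eigenvalue :: "real^'m^'m \<Rightarrow> real \<Rightarrow> bool" where
  "eigenvalue A l \<longleftrightarrow> (\<exists>x. x \<noteq> 0 \<and> A *v x = l *\<^sub>R x)"

text \<open>Intended for symmetric matrices, whose real spectrum is finite and nonempty;
  in general only the real eigenvalues are considered.\<close>

definition largest_eigenvalue :: "real^'m^'m \<Rightarrow> real" where
  "largest_eigenvalue A = Max {l. eigenvalue A l}"

text \<open>The second parameter of \<^const>\<open>normal_density\<close> is the standard deviation, whereas the
  parameter of the law below is the variance; the law of variance 0 is the point mass at 0.\<close>

definition centered_normal :: "real \<Rightarrow> real measure" where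
  "centered_normal s = (if s = 0 then return borel 0 else density lborel (normal_density 0 (sqrt s)))"

definition covariance_matrix :: "real^'m^'m \<Rightarrow> bool" where
  "covariance_matrix \<Sigma> \<longleftrightarrow> transpose \<Sigma> = \<Sigma> \<and> (\<forall>u. 0 \<le> u \<bullet> (\<Sigma> *v u))"

text \<open>The law \<open>N\<close> is \<open>N\<^sub>m(0,\<Sigma>)\<close>. As is standard when \<open>\<Sigma>\<close> may be singular, the multivariate normal
  law is defined by requiring every linear functional \<open>u\<^sup>T z\<close> to be normal with mean 0 and
  variance \<open>u\<^sup>T \<Sigma> u\<close>; this determines \<open>N\<close> uniquely (Cramer-Wold).\<close>

definition mv_normal :: "real^'m^'m \<Rightarrow> (real^'m) measure \<Rightarrow> bool" where
  "mv_normal \<Sigma> N \<longleftrightarrow> covariance_matrix \<Sigma> \<and> prob_space N \<and> sets N = sets borel \<and>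
     (\<forall>u. distr N borel (\<lambda>z. u \<bullet> z) = centered_normal (u \<bullet> (\<Sigma> *v u)))"

definition wishart :: "nat \<Rightarrow> real^'m^'m \<Rightarrow> (real^'m^'m) measure \<Rightarrow> bool" where
  "wishart n \<Sigma> W \<longleftrightarrow> (\<exists>N. mv_normal \<Sigma> N \<and>
     W = distr (PiM {..<n} (\<lambda>_. N)) borel (\<lambda>z. \<Sum>i<n. outer (z i)))"

text \<open>For \<open>k = 0\<close> the sum is empty, so \<open>chi_squared 0\<close> is the point mass at 0.\<close>

definition chi_squared :: "nat \<Rightarrow> real measure" where
  "chi_squared k = distr (PiM {..<k} (\<lambda>_. density lborel std_normal_density)) borel
     (\<lambda>z. \<Sum>i<k. (z i)\<^sup>2)"

text \<open>\<open>R t = o\<^sub>p(a t)\<close> along the filter \<open>F\<close>, where each \<open>R t\<close> is a random variable on its own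
  probability space \<open>M t\<close>. Measurability is part of the definition because \<^const>\<open>measure\<close>
  returns 0 on sets that are not measurable.\<close>

definition small_o_p ::
  "('t \<Rightarrow> 'w measure) \<Rightarrow> ('t \<Rightarrow> 'w \<Rightarrow> real) \<Rightarrow> ('t \<Rightarrow> real) \<Rightarrow> 't filter \<Rightarrow> bool" where
  "small_o_p M R a F \<longleftrightarrow>
     (\<forall>\<^sub>F t in F. prob_space (M t) \<and> R t \<in> borel_measurable (M t)) \<and>
     (\<forall>\<epsilon>>0. ((\<lambda>t. measure (M t) {\<omega> \<in> space (M t). \<bar>R t \<omega> / a t\<bar> > \<epsilon>}) \<longlongrightarrow> 0) F)"

end

theory Submission
  imports Defs
begin

text \<open>Choose \<open>L : \<real>\<^sup>m \<rightarrow> v\<^sup>\<bottom>\<close> linear that kills one coordinate and is isometric on the others. A sample of size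
  \<open>n\<close> from \<open>N(0, \<sigma>\<^sup>2 I + \<lambda> v v\<^sup>T)\<close> is \<open>x\<^sub>i \<tau> v + \<sigma> L y\<^sub>i\<close> with \<open>\<tau>\<^sup>2 = \<lambda> + \<sigma>\<^sup>2\<close> and \<open>x\<^sub>i\<close>, \<open>y\<^sub>i\<close> standard normal. For
  fixed \<open>x\<close>, rotations of the sample index that collect \<open>x\<close> in one coordinate preserve both the Gram
  matrix and the law of \<open>y\<close>, so that \<open>H\<close> has the law of
  \<open>h h\<^sup>T + \<sigma>\<^sup>2 \<Sum>\<^bsub>i<n-1\<^esub> L w\<^sub>i (L w\<^sub>i)\<^sup>T\<close> where \<open>h = \<surd>A \<tau> v + \<sigma> L y\<close>, with \<open>A = \<bar>x\<bar>\<^sup>2\<close> chi-squared and \<open>y\<close>, \<open>w\<^sub>i\<close> independent standard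
  normal. Put \<open>B = \<bar>L y\<bar>\<^sup>2\<close> and \<open>C = \<Sum>\<^sub>i (d \<bullet> w\<^sub>i)\<^sup>2\<close>, where \<open>d\<close> is the unit vector with
  \<open>\<bar>L y\<bar> (d \<bullet> w) = L y \<bullet> L w\<close>; given \<open>y\<close>, \<open>C\<close> is chi-squared whatever \<open>y\<close> is, so \<open>A\<close>, \<open>B\<close>, \<open>C\<close> are independent.
  The eigenvalue equation, tested against \<open>v\<close>, \<open>L y\<close> and \<open>\<Sum>\<^sub>i (L w\<^sub>i \<bullet> L y) L w\<^sub>i\<close>, then yields the
  expansion with an error \<open>O(\<sigma>\<^sup>6)\<close> at every sample point with \<open>A > 0\<close>, hence in probability.\<close>

subsection \<open>Largest eigenvalue of a symmetric matrix\<close>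

lemma outer_mult_vec: "outer p *v x = (p \<bullet> x) *\<^sub>R p"
  by (simp add: vec_eq_iff outer_def matrix_vector_mult_def inner_vec_def sum_distrib_left sum_distrib_right mult_ac)

lemma transpose_outer: "transpose (outer p) = outer p"
  by (simp add: vec_eq_iff outer_def transpose_def mult.commute)

lemma sum_matrix_vector_mult: "(\<Sum>i\<in>I. F i) *v (x :: real^'n) = (\<Sum>i\<in>I. F i *v x)"
  by (induction I rule: infinite_finite_induct) (simp_all add: matrix_vector_mult_add_rdistrib)

lemma transpose_sum: "transpose (\<Sum>i\<in>I. F i) = (\<Sum>i\<in>I. transpose (F i))"
  by (simp add: vec_eq_iff transpose_def)

lemma transpose_add: "transpose (A + B) = transpose A + transpose B"
  by (simp add: vec_eq_iff transpose_def)

lemma symmetric_inner: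
  fixes A :: "real^'n^'n"
  assumes "transpose A = A"
  shows "x \<bullet> (A *v y) = (A *v x) \<bullet> y"
  using dot_lmul_matrix[of x A y] vector_transpose_matrix[of x A] assms by simp

text \<open>The quadratic form attains its maximum \<open>l\<close> over the compact unit sphere at
  some \<open>x0\<close>. Maximality along \<open>x0 + t *\<^sub>R g\<close>, where \<open>g\<close>
  is the residual \<open>A *v x0 - l *\<^sub>R x0\<close>, bounds a first-order gain by a term of
  second order in \<open>t\<close>, which forces \<open>g = 0\<close>.\<close>

lemma symmetric_max_eigenvector:
  fixes A :: "real^'n^'n"
  assumes sym: "transpose A = A"
  obtains l where "eigenvalue A l" "\<And>x. x \<bullet> (A *v x) \<le> l * (x \<bullet> x)"
proof -
  have "sphere (0::real^'n) 1 \<noteq> {}"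
    by simp
  moreover have "continuous_on (sphere 0 1) (\<lambda>x. x \<bullet> (A *v x))"
    by (intro continuous_intros matrix_vector_mult_linear_continuous_on)
  ultimately obtain x0 where x0: "norm x0 = 1"
    and max: "\<And>y. norm y = 1 \<Longrightarrow> y \<bullet> (A *v y) \<le> x0 \<bullet> (A *v x0)"
    using continuous_attains_sup[OF compact_sphere, of "0::real^'n" 1 "\<lambda>x. x \<bullet> (A *v x)"] by auto
  define l where "l = x0 \<bullet> (A *v x0)"
  have le: "x \<bullet> (A *v x) \<le> l * (x \<bullet> x)" for x
  proof (cases "x = 0")
    case False
    then have "norm (x /\<^sub>R norm x) = 1" by simp
    from max[OF this] have "(x \<bullet> (A *v x)) / (norm x)\<^sup>2 \<le> l"
      by (simp add: l_def matrix_vector_mult_scaleR power2_eq_square field_simps)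
    then show ?thesis using False
      by (simp add: divide_simps power2_norm_eq_inner mult.commute split: if_splits)
  qed simp
  define g where "g = A *v x0 - l *\<^sub>R x0"
  define K where "K = l * (g \<bullet> g) - g \<bullet> (A *v g)"
  have "2 * (g \<bullet> g) \<le> t * K" if t: "t > 0" for t
  proof -
    have xx: "x0 \<bullet> x0 = 1" using x0 by (simp add: norm_eq_1)
    have s: "x0 \<bullet> (A *v g) = g \<bullet> (A *v x0)" using symmetric_inner[OF sym, of x0 g] by (simp add: inner_commute)
    have "l + 2 * t * (g \<bullet> (A *v x0)) + t * (t * (g \<bullet> (A *v g)))
        = (x0 + t *\<^sub>R g) \<bullet> (A *v (x0 + t *\<^sub>R g))"
      using s by (simp add: l_def matrix_vector_right_distrib matrix_vector_mult_scaleR inner_add_left inner_add_right algebra_simps)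
    also have "\<dots> \<le> l * ((x0 + t *\<^sub>R g) \<bullet> (x0 + t *\<^sub>R g))"
      by (rule le)
    also have "\<dots> = l + 2 * t * (l * (x0 \<bullet> g)) + t * (t * (l * (g \<bullet> g)))"
      using xx by (simp add: inner_add_left inner_add_right inner_commute algebra_simps)
    finally have "2 * t * (g \<bullet> (A *v x0) - l * (x0 \<bullet> g)) \<le> t * (t * K)"
      unfolding K_def by (simp only: right_diff_distrib)
    moreover have "g \<bullet> g = g \<bullet> (A *v x0) - l * (x0 \<bullet> g)"
      by (subst (2) g_def) (simp add: inner_diff_right inner_commute)
    ultimately have "2 * t * (g \<bullet> g) \<le> t * (t * K)"
      by (simp only:)
    then have "t * (2 * (g \<bullet> g)) \<le> t * (t * K)"
      by (simp only: mult_ac)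
    then show ?thesis using t by simp
  qed note small = this
  have "g \<bullet> g \<le> 0"
  proof (rule ccontr)
    assume "\<not> g \<bullet> g \<le> 0"
    then have g: "g \<bullet> g > 0" by (simp only: not_le)
    \<comment> \<open>The step length \<open>t\<close> is taken as
      \<open>(g \<bullet> g) / (\<bar>K\<bar> + 1)\<close>, so that \<open>t * K\<close> cannot
      exceed \<open>g \<bullet> g\<close>, half of the required lower bound.\<close>
    have "2 * (g \<bullet> g) \<le> (g \<bullet> g) / (\<bar>K\<bar> + 1) * K" using g by (intro small) (simp add: add_nonneg_pos)
    also have "\<dots> \<le> (g \<bullet> g) / (\<bar>K\<bar> + 1) * (\<bar>K\<bar> + 1)"
      using g by (intro mult_left_mono) auto
    finally show False using g by (simp add: add_nonneg_eq_0_iff)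
  qed
  then have "g = 0" by (metis inner_eq_zero_iff inner_ge_zero order_antisym)
  then have "eigenvalue A l" unfolding eigenvalue_def g_def using x0
    by (intro exI[of _ x0]) auto
  with le show thesis using that by blast
qed

text \<open>Eigenvectors for distinct eigenvalues are orthogonal, hence independent, and an
  independent set in finite dimension is finite. Finiteness is what gives the \<open>Max\<close> in
  \<open>largest_eigenvalue\<close> its meaning.\<close>

lemma finite_symmetric_eigenvalues:
  fixes A :: "real^'n^'n"
  assumes sym: "transpose A = A"
  shows "finite {l. eigenvalue A l}"
proof -
  define f where "f = (\<lambda>l. SOME x. x \<noteq> 0 \<and> A *v x = l *\<^sub>R x)"
  have f: "f l \<noteq> 0 \<and> A *v f l = l *\<^sub>R f l" if "eigenvalue A l" for l
    using that unfolding eigenvalue_def f_def by (rule someI_ex)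
  have orth: "f l \<bullet> f k = 0" if "eigenvalue A l" "eigenvalue A k" "l \<noteq> k" for l k
  proof -
    have "k * (f l \<bullet> f k) = l * (f l \<bullet> f k)"
      using symmetric_inner[OF sym, of "f l" "f k"] f[OF that(1)] f[OF that(2)] by simp
    then show ?thesis using that(3) by simp
  qed
  have "independent (f ` {l. eigenvalue A l})"
    using f orth by (intro pairwise_orthogonal_independent) (auto simp: pairwise_def orthogonal_def)
  then have "finite (f ` {l. eigenvalue A l})" by (rule independent_imp_finite)
  moreover have "inj_on f {l. eigenvalue A l}"
    using f orth by (intro inj_onI) (metis inner_eq_zero_iff mem_Collect_eq)
  ultimately show ?thesis by (rule finite_imageD)
qed

text \<open>An eigenvalue \<open>l\<close> that dominates the Rayleigh quotient dominates every
  other eigenvalue, as seen by testing with the eigenvector, so it is the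
  \<open>Max\<close>.\<close>

lemma
  fixes A :: "real^'n^'n"
  assumes sym: "transpose A = A"
  shows eigenvalue_largest_eigenvalue: "eigenvalue A (largest_eigenvalue A)"
    and rayleigh_le_largest_eigenvalue: "x \<bullet> (A *v x) \<le> largest_eigenvalue A * (x \<bullet> x)"
proof -
  obtain l where l: "eigenvalue A l" "\<And>x. x \<bullet> (A *v x) \<le> l * (x \<bullet> x)"
    using symmetric_max_eigenvector[OF sym] by blast
  have "k \<le> l" if "eigenvalue A k" for k
  proof -
    from that obtain x where "x \<noteq> 0" "A *v x = k *\<^sub>R x" by (auto simp: eigenvalue_def)
    then show ?thesis using l(2)[of x] by simp
  qed
  then have "largest_eigenvalue A = l"
    unfolding largest_eigenvalue_def using l(1)
    by (intro Max_eqI finite_symmetric_eigenvalues[OF sym]) auto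
  then show "eigenvalue A (largest_eigenvalue A)" "x \<bullet> (A *v x) \<le> largest_eigenvalue A * (x \<bullet> x)"
    using l by auto
qed

section \<open>Measurability of the largest eigenvalue\<close>

lemma largest_eigenvalue_le_iff:
  fixes A :: "real^'n^'n"
  assumes sym: "transpose A = A"
  shows "largest_eigenvalue A \<le> t \<longleftrightarrow> (\<forall>x. x \<bullet> (A *v x) \<le> t * (x \<bullet> x))"
proof
  assume "largest_eigenvalue A \<le> t"
  then show "\<forall>x. x \<bullet> (A *v x) \<le> t * (x \<bullet> x)"
    by (meson rayleigh_le_largest_eigenvalue[OF sym] mult_right_mono inner_ge_zero order_trans)
next
  assume *: "\<forall>x. x \<bullet> (A *v x) \<le> t * (x \<bullet> x)"
  obtain x where "x \<noteq> 0" "A *v x = largest_eigenvalue A *\<^sub>R x"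
    using eigenvalue_largest_eigenvalue[OF sym] by (auto simp: eigenvalue_def)
  with *[rule_format, of x] show "largest_eigenvalue A \<le> t" by simp
qed

text \<open>A sublevel set is the intersection, over all vectors \<open>x\<close>, of measurable
  conditions on the quadratic form. Each condition is closed in \<open>x\<close>, so a countable
  dense set of vectors suffices.\<close>

lemma borel_measurable_largest_eigenvalue:
  fixes H :: "'a \<Rightarrow> real^'n^'n"
  assumes [measurable]: "H \<in> borel_measurable M" and sym: "\<And>\<omega>. transpose (H \<omega>) = H \<omega>"
  shows "(\<lambda>\<omega>. largest_eigenvalue (H \<omega>)) \<in> borel_measurable M"
proof (rule borel_measurable_iff_le[THEN iffD2], intro allI)
  fix t
  obtain D :: "(real^'n) set" where D: "countable D"
    and dense: "\<And>X. open X \<Longrightarrow> X \<noteq> {} \<Longrightarrow> \<exists>d\<in>D. d \<in> X"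
    by (rule countable_dense_setE) blast
  have "closure D = UNIV"
    using dense[of "- closure D"] closure_subset[of D] by (auto simp: open_Compl)
  note D = D this
  have "(\<forall>x. x \<bullet> (H \<omega> *v x) \<le> t * (x \<bullet> x)) \<longleftrightarrow> (\<forall>x\<in>D. x \<bullet> (H \<omega> *v x) \<le> t * (x \<bullet> x))" for \<omega>
  proof (intro iffI ballI allI)
    fix x assume *: "\<forall>x\<in>D. x \<bullet> (H \<omega> *v x) \<le> t * (x \<bullet> x)"
    have "closed {x. x \<bullet> (H \<omega> *v x) \<le> t * (x \<bullet> x)}"
      by (intro closed_Collect_le continuous_intros matrix_vector_mult_linear_continuous_on)
    with * have "closure D \<subseteq> {x. x \<bullet> (H \<omega> *v x) \<le> t * (x \<bullet> x)}"
      by (intro closure_minimal) auto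
    with D show "x \<bullet> (H \<omega> *v x) \<le> t * (x \<bullet> x)" by auto
  qed blast
  moreover have "(\<lambda>\<omega>. x \<bullet> (H \<omega> *v x)) \<in> borel_measurable M" for x
  proof (rule measurable_compose[OF assms(1)])
    show "(\<lambda>A::real^'n^'n. x \<bullet> (A *v x)) \<in> borel_measurable borel"
      unfolding inner_vec_def matrix_vector_mult_def
      by (intro borel_measurable_continuous_onI continuous_intros) 
  qed
  then have "{\<omega>\<in>space M. \<forall>x\<in>D. x \<bullet> (H \<omega> *v x) \<le> t * (x \<bullet> x)} \<in> sets M"
    using D(1) by measurable
  ultimately show "{\<omega>\<in>space M. largest_eigenvalue (H \<omega>) \<le> t} \<in> sets M"
    by (simp add: largest_eigenvalue_le_iff[OF sym])
qed

subsection \<open>Eigenvalue expansion at a sample point\<close>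

text \<open>The Gram matrix after the spike has been collected into a single sample vector:
  \<open>p\<close> will be a multiple of \<open>v\<close>, while \<open>u\<close> and the
  \<open>r\<close> vectors \<open>w i\<close> will be noise orthogonal to \<open>v\<close>.\<close>

definition spiked_gram :: "real^'m \<Rightarrow> real^'m \<Rightarrow> (nat \<Rightarrow> real^'m) \<Rightarrow> nat \<Rightarrow> real^'m^'m" where
  "spiked_gram p u w r = outer (p + u) + (\<Sum>i<r. outer (w i))"

lemma transpose_spiked_gram: "transpose (spiked_gram p u w r) = spiked_gram p u w r"
  by (simp add: spiked_gram_def transpose_add transpose_sum transpose_outer)

lemma spiked_gram_mult_vec:
  "spiked_gram p u w r *v x = ((p + u) \<bullet> x) *\<^sub>R (p + u) + (\<Sum>i<r. (w i \<bullet> x) *\<^sub>R w i)"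
  by (simp add: spiked_gram_def matrix_vector_mult_add_rdistrib sum_matrix_vector_mult outer_mult_vec)

text \<open>With the eigenvector normalized to \<open>v \<bullet> x = 1\<close>, three scalar
  consequences of the eigenvalue equation determine \<open>l\<close> exactly up to the quantity
  \<kappa>. The rest is bounded by the part of the eigenvector orthogonal to \<open>v\<close>, which
  is of order \<open>s\<close>.\<close>

lemma spiked_gram_eigenvalue_bound:
  fixes v u :: "real^'m" and w :: "nat \<Rightarrow> real^'m" and r :: nat and s :: real
  defines "B \<equiv> u \<bullet> u" and "Q \<equiv> \<Sum>i<r. (w i \<bullet> u)\<^sup>2" and "W \<equiv> \<Sum>i<r. (norm (w i))\<^sup>2"
    and "K \<equiv> \<Sum>i<r. \<Sum>j<r. \<bar>w i \<bullet> u\<bar> * norm (w j) * \<bar>w i \<bullet> w j\<bar>"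
  assumes v: "norm v = 1" and uv: "u \<bullet> v = 0" and wv: "\<And>i. w i \<bullet> v = 0"
    and a: "0 < a" and s: "0 < s" and small: "s\<^sup>2 * (W + B) \<le> a\<^sup>2 / 2"
  defines "l \<equiv> largest_eigenvalue (spiked_gram (a *\<^sub>R v) (s *\<^sub>R u) (\<lambda>i. s *\<^sub>R w i) r)"
  shows "\<bar>l - (a\<^sup>2 + s\<^sup>2 * B + s^4 * Q / a\<^sup>2)\<bar> \<le> s^6 * (2 * Q * B / a^4 + 2 * norm u * K / a^4)"
proof -
  define H where "H = spiked_gram (a *\<^sub>R v) (s *\<^sub>R u) (\<lambda>i. s *\<^sub>R w i) r"
  have sym: "transpose H = H" by (simp add: H_def transpose_spiked_gram)
  have vv: "v \<bullet> v = 1" using v by (simp add: norm_eq_1)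
  have vu: "v \<bullet> u = 0" and vw: "v \<bullet> w i = 0" for i using uv wv by (simp_all add: inner_commute)
  have Hx: "H *v x = (a * (v \<bullet> x) + s * (u \<bullet> x)) *\<^sub>R (a *\<^sub>R v + s *\<^sub>R u) + (\<Sum>i<r. (s\<^sup>2 * (w i \<bullet> x)) *\<^sub>R w i)" for x
    by (simp add: H_def spiked_gram_mult_vec inner_add_left power2_eq_square mult_ac)
  have "v \<bullet> (H *v v) = a\<^sup>2"
    by (simp add: Hx inner_add_right inner_sum_right vv vu uv wv vw power2_eq_square)
  then have al: "a\<^sup>2 \<le> l"
    using rayleigh_le_largest_eigenvalue[OF sym, of v] vv by (simp add: l_def H_def)
  have a2: "0 < a\<^sup>2" using a by simp
  have l0: "0 < l" using al a2 by linarith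
  obtain x' where x': "x' \<noteq> 0" "H *v x' = l *\<^sub>R x'"
    using eigenvalue_largest_eigenvalue[OF sym] by (auto simp: eigenvalue_def l_def H_def)
  \<comment> \<open>The component of the eigenvalue equation orthogonal to \<open>v\<close> has the
    factor \<open>l \<ge> a\<^sup>2\<close> on the left; the hypothesis \<open>small\<close> lets
    the noise terms on the right be absorbed into half of it.\<close>
  have perp: "norm (x - (v \<bullet> x) *\<^sub>R v) * (a\<^sup>2 / 2) \<le> a * s * norm u * \<bar>v \<bullet> x\<bar>" if x: "H *v x = l *\<^sub>R x" for x
  proof -
    define y where "y = x - (v \<bullet> x) *\<^sub>R v"
    have uy: "u \<bullet> x = u \<bullet> y" and wy: "w i \<bullet> x = w i \<bullet> y" for i
      by (simp_all add: y_def inner_diff_right uv wv)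
    have vx: "l * (v \<bullet> x) = a * (a * (v \<bullet> x) + s * (u \<bullet> x))"
      using arg_cong[OF x, of "\<lambda>z. v \<bullet> z"]
      by (simp add: Hx inner_add_right inner_sum_right vv vu vw mult_ac)
    have "l *\<^sub>R y = (a * (v \<bullet> x) + s * (u \<bullet> x)) *\<^sub>R (s *\<^sub>R u) + (\<Sum>i<r. (s\<^sup>2 * (w i \<bullet> x)) *\<^sub>R w i)"
      using x vx by (simp add: Hx y_def scaleR_diff_right algebra_simps)
    then have "l * norm y = norm ((a * (v \<bullet> x) + s * (u \<bullet> x)) *\<^sub>R (s *\<^sub>R u) + (\<Sum>i<r. (s\<^sup>2 * (w i \<bullet> x)) *\<^sub>R w i))"
      using l0 by (metis abs_of_pos norm_scaleR)
    also have "\<dots> \<le> \<bar>a * (v \<bullet> x) + s * (u \<bullet> x)\<bar> * (s * norm u) + (\<Sum>i<r. s\<^sup>2 * \<bar>w i \<bullet> x\<bar> * norm (w i))"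
      using s by (intro order_trans[OF norm_triangle_ineq] add_mono order_trans[OF norm_sum] sum_mono)
        (simp_all add: abs_mult)
    also have "\<dots> \<le> (a * \<bar>v \<bullet> x\<bar> + s * (norm u * norm y)) * (s * norm u) + (\<Sum>i<r. s\<^sup>2 * (norm (w i) * norm y) * norm (w i))"
    proof (intro add_mono sum_mono mult_right_mono mult_left_mono)
      have "\<bar>a * (v \<bullet> x) + s * (u \<bullet> x)\<bar> \<le> a * \<bar>v \<bullet> x\<bar> + s * \<bar>u \<bullet> x\<bar>"
        using a s by (intro order_trans[OF abs_triangle_ineq]) (simp add: abs_mult)
      also have "\<dots> \<le> a * \<bar>v \<bullet> x\<bar> + s * (norm u * norm y)"
        using s by (simp add: uy Cauchy_Schwarz_ineq2)
      finally show "\<bar>a * (v \<bullet> x) + s * (u \<bullet> x)\<bar> \<le> a * \<bar>v \<bullet> x\<bar> + s * (norm u * norm y)" .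
    qed (use s in \<open>auto simp: wy Cauchy_Schwarz_ineq2\<close>)
    also have "\<dots> = a * s * norm u * \<bar>v \<bullet> x\<bar> + s\<^sup>2 * (W + B) * norm y"
      by (simp add: W_def B_def power2_norm_eq_inner[symmetric] sum_distrib_left sum_distrib_right
          algebra_simps power2_eq_square)
    also have "\<dots> \<le> a * s * norm u * \<bar>v \<bullet> x\<bar> + a\<^sup>2 / 2 * norm y"
      using small by (intro add_left_mono mult_right_mono) auto
    finally have "l * norm y \<le> a * s * norm u * \<bar>v \<bullet> x\<bar> + a\<^sup>2 / 2 * norm y" .
    moreover have "a\<^sup>2 * norm y \<le> l * norm y" using al by (intro mult_right_mono) auto
    ultimately show ?thesis by (simp add: y_def algebra_simps)
  qed
  \<comment> \<open>An eigenvector orthogonal to \<open>v\<close> would vanish by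
    \<open>perp\<close>, so division by \<open>v \<bullet> x'\<close> is legitimate.\<close>
  have "v \<bullet> x' \<noteq> 0"
  proof
    assume "v \<bullet> x' = 0"
    with perp[OF x'(2)] a x'(1) show False by (simp add: mult_le_0_iff)
  qed
  define x where "x = x' /\<^sub>R (v \<bullet> x')"
  have x: "H *v x = l *\<^sub>R x" and vx1: "v \<bullet> x = 1"
    using x' \<open>v \<bullet> x' \<noteq> 0\<close> by (simp_all add: x_def matrix_vector_mult_scaleR)
  define y where "y = x - v"
  have uy: "u \<bullet> x = u \<bullet> y" and wy: "w i \<bullet> x = w i \<bullet> y" for i
    by (simp_all add: y_def inner_diff_right uv wv)
  have ny: "norm y \<le> 2 * s * norm u / a"
    using perp[OF x] a by (simp add: vx1 y_def field_simps power2_eq_square)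
  \<comment> \<open>\<beta> and \<gamma> are the unknowns to be eliminated; \<kappa> is what remains
    after testing with the combination of the \<open>w i\<close> with weights
    \<open>w i \<bullet> u\<close>, and only its size matters.\<close>
  define \<beta> where "\<beta> = u \<bullet> x"
  define \<gamma> where "\<gamma> = (\<Sum>i<r. (w i \<bullet> u) * (w i \<bullet> x))"
  define \<kappa> where "\<kappa> = (\<Sum>i<r. \<Sum>j<r. (w i \<bullet> u) * (w j \<bullet> x) * (w i \<bullet> w j))"
  have e1: "l = a\<^sup>2 + a * s * \<beta>"
    using arg_cong[OF x, of "\<lambda>z. v \<bullet> z"]
    by (simp add: Hx inner_add_right inner_sum_right vv vu vw vx1 \<beta>_def power2_eq_square algebra_simps)
  have e2: "l * \<beta> = (a + s * \<beta>) * s * B + s\<^sup>2 * \<gamma>"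
    using arg_cong[OF x, of "\<lambda>z. u \<bullet> z"]
    by (simp add: Hx inner_add_right inner_sum_right uv vx1 \<beta>_def \<gamma>_def B_def sum_distrib_left inner_commute mult_ac)
  have e3: "l * \<gamma> = (a + s * \<beta>) * s * Q + s\<^sup>2 * \<kappa>"
  proof -
    have "l * (w i \<bullet> x) = (a + s * \<beta>) * s * (w i \<bullet> u) + s\<^sup>2 * (\<Sum>j<r. (w j \<bullet> x) * (w i \<bullet> w j))" for i
      using arg_cong[OF x, of "\<lambda>z. w i \<bullet> z"]
      by (simp add: Hx inner_add_right inner_sum_right wv vx1 \<beta>_def sum_distrib_left mult_ac)
    then have "(w i \<bullet> u) * (l * (w i \<bullet> x)) = (w i \<bullet> u) * ((a + s * \<beta>) * s * (w i \<bullet> u) + s\<^sup>2 * (\<Sum>j<r. (w j \<bullet> x) * (w i \<bullet> w j)))" for i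
      by simp
    then have "l * \<gamma> = (\<Sum>i<r. (w i \<bullet> u) * ((a + s * \<beta>) * s * (w i \<bullet> u) + s\<^sup>2 * (\<Sum>j<r. (w j \<bullet> x) * (w i \<bullet> w j))))"
      unfolding \<gamma>_def sum_distrib_left by (intro sum.cong refl) (simp add: mult_ac)
    also have "\<dots> = (a + s * \<beta>) * s * Q + s\<^sup>2 * \<kappa>"
      by (simp add: Q_def \<kappa>_def distrib_left sum.distrib sum_distrib_left power2_eq_square mult_ac)
    finally show ?thesis .
  qed
  have K0: "0 \<le> K" and Q0: "0 \<le> Q" and B0: "0 \<le> B" unfolding K_def Q_def B_def by (auto intro!: sum_nonneg)
  have \<kappa>_le: "\<bar>\<kappa>\<bar> \<le> K * norm y"
    unfolding \<kappa>_def K_def sum_distrib_right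
    by (intro order_trans[OF sum_abs] sum_mono)
       (auto simp: abs_mult wy Cauchy_Schwarz_ineq2 intro!: mult_right_mono mult_left_mono simp: mult.assoc
         , metis Cauchy_Schwarz_ineq2 abs_ge_zero mult.assoc mult.commute mult_right_mono)
  \<comment> \<open>Substituting \<open>l / a\<close> for the projection
    \<open>a + s * \<beta>\<close> makes \<open>e2\<close> and \<open>e3\<close> linear in \<beta>
    and \<gamma>, with coefficients that involve only \<open>l\<close>.\<close>
  have asb: "a + s * \<beta> = l / a" using e1 a by (simp add: field_simps power2_eq_square)
  have d: "\<bar>l - a\<^sup>2\<bar> \<le> 2 * B * s\<^sup>2"
  proof -
    have "\<bar>l - a\<^sup>2\<bar> = a * s * \<bar>u \<bullet> y\<bar>" using a s by (simp add: e1 abs_mult \<beta>_def uy)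
    also have "\<dots> \<le> a * s * (norm u * (2 * s * norm u / a))"
      using a s ny by (intro mult_left_mono order_trans[OF Cauchy_Schwarz_ineq2] mult_left_mono) auto
    also have "\<dots> = 2 * B * s\<^sup>2"
      using a by (simp add: B_def power2_norm_eq_inner[symmetric] power2_eq_square)
    finally show ?thesis .
  qed
  \<comment> \<open>Back substitution gives \<open>l - a\<^sup>2\<close> exactly, with
    \<open>s^4 * Q / l\<close> as its middle term. Replacing \<open>l\<close> by
    \<open>a\<^sup>2\<close> in that denominator produces the first error term; \<kappa> produces
    the second.\<close>
  have main: "l - (a\<^sup>2 + s\<^sup>2 * B + s^4 * Q / a\<^sup>2) = - (s^4 * Q * (l - a\<^sup>2) / (l * a\<^sup>2)) + s^5 * a * \<kappa> / l\<^sup>2"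
  proof -
    have "\<gamma> = s * Q / a + s\<^sup>2 * \<kappa> / l" using e3[unfolded asb] l0 a by (simp add: field_simps)
    then have "l * \<beta> = l / a * s * B + s\<^sup>2 * (s * Q / a + s\<^sup>2 * \<kappa> / l)" using e2 by (simp add: asb)
    then have beta: "\<beta> = s * B / a + s^3 * Q / (a * l) + s^4 * \<kappa> / l\<^sup>2"
      using l0 a by (simp add: field_simps power2_eq_square power3_eq_cube power4_eq_xxxx)
    have "l - a\<^sup>2 = a * s * \<beta>" using e1 by simp
    also have "\<dots> = a * s * (s * B / a + s^3 * Q / (a * l) + s^4 * \<kappa> / l\<^sup>2)"
      by (rule arg_cong[OF beta])
    also have "\<dots> = s\<^sup>2 * B + s^4 * Q / l + s^5 * a * \<kappa> / l\<^sup>2"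
      using a by (simp add: distrib_left eval_nat_numeral mult_ac)
    finally have "l - a\<^sup>2 = s\<^sup>2 * B + s^4 * Q / l + s^5 * a * \<kappa> / l\<^sup>2" .
    moreover have "s^4 * Q / l - s^4 * Q / a\<^sup>2 = - (s^4 * Q * (l - a\<^sup>2) / (l * a\<^sup>2))"
      using l0 a by (simp add: field_simps)
    ultimately show ?thesis by linarith
  qed
  have a4: "a^4 = a\<^sup>2 * a\<^sup>2" by (simp add: power4_eq_xxxx power2_eq_square)
  have al2: "a^4 \<le> l\<^sup>2"
    unfolding a4 power2_eq_square[of l] using al l0 by (intro mult_mono) auto
  have al3: "a^4 \<le> l * a\<^sup>2"
    unfolding a4 using al by (intro mult_right_mono) auto
  have "\<bar>l - (a\<^sup>2 + s\<^sup>2 * B + s^4 * Q / a\<^sup>2)\<bar> \<le> \<bar>s^4 * Q * (l - a\<^sup>2) / (l * a\<^sup>2)\<bar> + \<bar>s^5 * a * \<kappa> / l\<^sup>2\<bar>"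
    unfolding main by (rule order_trans[OF abs_triangle_ineq]) simp
  also have "\<bar>s^4 * Q * (l - a\<^sup>2) / (l * a\<^sup>2)\<bar> = s^4 * Q * \<bar>l - a\<^sup>2\<bar> / (l * a\<^sup>2)"
    using Q0 l0 s by (simp add: abs_mult)
  also have "\<dots> \<le> s^4 * Q * (2 * B * s\<^sup>2) / a^4"
    using Q0 B0 s a by (intro frac_le mult_left_mono d al3) auto
  also have "\<bar>s^5 * a * \<kappa> / l\<^sup>2\<bar> = s^5 * a * \<bar>\<kappa>\<bar> / l\<^sup>2"
    using a s by (simp add: abs_mult)
  also have "\<dots> \<le> s^5 * a * (K * (2 * s * norm u / a)) / a^4"
    using K0 s a order_trans[OF \<kappa>_le mult_left_mono[OF ny K0]]
    by (intro frac_le mult_left_mono al2) auto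
  also have "s^4 * Q * (2 * B * s\<^sup>2) / a^4 = s^6 * (2 * Q * B / a^4)"
    by (simp add: eval_nat_numeral mult_ac)
  also have "s^5 * a * (K * (2 * s * norm u / a)) = s^6 * (2 * norm u * K)"
    using a by (simp add: eval_nat_numeral mult_ac)
  also have "s^6 * (2 * Q * B / a^4) + s^6 * (2 * norm u * K) / a^4 = s^6 * (2 * Q * B / a^4 + 2 * norm u * K / a^4)"
    by (simp add: distrib_left)
  finally show "\<bar>l - (a\<^sup>2 + s\<^sup>2 * B + s^4 * Q / a\<^sup>2)\<bar> \<le> s^6 * (2 * Q * B / a^4 + 2 * norm u * K / a^4)"
    by simp
qed

text \<open>The preceding bound with \<open>a\<^sup>2 = (lam + s\<^sup>2) * A\<close>: since
  \<open>a\<^sup>2\<close> stays above \<open>lam * A\<close>, the error divided by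
  \<open>s^4\<close> is at most a constant times \<open>s\<^sup>2\<close>. \<open>C\<close> enters
  only through \<open>BC\<close>, a form without division that covers \<open>u = 0\<close>.\<close>

lemma spiked_gram_asymptotics:
  fixes v u :: "real^'m" and w :: "nat \<Rightarrow> real^'m"
  assumes v: "norm v = 1" and uv: "u \<bullet> v = 0" and wv: "\<And>i. w i \<bullet> v = 0"
    and A: "0 < A" and lam: "0 < lam"
    and BC: "u \<bullet> u * C = (\<Sum>i<r. (w i \<bullet> u)\<^sup>2)"
  shows "((\<lambda>s. (largest_eigenvalue (spiked_gram ((sqrt A * sqrt (lam + s\<^sup>2)) *\<^sub>R v) (s *\<^sub>R u) (\<lambda>i. s *\<^sub>R w i) r)
      - ((lam + s\<^sup>2) * A + (u \<bullet> u) * s\<^sup>2 + (u \<bullet> u) * C / ((lam + s\<^sup>2) * A) * s^4)) / s^4) \<longlongrightarrow> 0) (at_right 0)"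
    (is "(?f \<longlongrightarrow> 0) _")
proof -
  define B Q W K where "B = u \<bullet> u" and "Q = (\<Sum>i<r. (w i \<bullet> u)\<^sup>2)" and "W = (\<Sum>i<r. (norm (w i))\<^sup>2)"
    and "K = (\<Sum>i<r. \<Sum>j<r. \<bar>w i \<bullet> u\<bar> * norm (w j) * \<bar>w i \<bullet> w j\<bar>)"
  have nonneg: "0 \<le> B" "0 \<le> Q" "0 \<le> K" unfolding B_def Q_def K_def by (auto intro!: sum_nonneg)
  define c where "c = (2 * Q * B + 2 * norm u * K) / (lam * A)\<^sup>2"
  have lA: "0 < lam * A" using A lam by simp
  have "((\<lambda>s::real. s\<^sup>2 * (W + B)) \<longlongrightarrow> 0\<^sup>2 * (W + B)) (at_right 0)"
    by (intro tendsto_intros)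
  then have "\<forall>\<^sub>F s in at_right 0. s\<^sup>2 * (W + B) < lam * A / 2"
    using lA by (intro order_tendstoD) auto
  moreover have "\<forall>\<^sub>F s in at_right (0::real). 0 < s" by (rule eventually_at_right_less)
  ultimately have "\<forall>\<^sub>F s in at_right 0. norm (?f s) \<le> s\<^sup>2 * c"
  proof eventually_elim
    case (elim s)
    define a where "a = sqrt A * sqrt (lam + s\<^sup>2)"
    define l where "l = largest_eigenvalue (spiked_gram (a *\<^sub>R v) (s *\<^sub>R u) (\<lambda>i. s *\<^sub>R w i) r)"
    have a: "0 < a" using A lam by (simp add: a_def add_pos_nonneg)
    have a2: "a\<^sup>2 = (lam + s\<^sup>2) * A"
      using A lam by (simp add: a_def power_mult_distrib mult.commute add_nonneg_nonneg)
    then have la: "lam * A \<le> a\<^sup>2" using A by (simp add: algebra_simps)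
    have "s\<^sup>2 * (W + B) \<le> a\<^sup>2 / 2" using elim(1) la by linarith
    from spiked_gram_eigenvalue_bound[OF v uv wv a elim(2) this[unfolded W_def B_def]]
    have "\<bar>l - (a\<^sup>2 + s\<^sup>2 * B + s^4 * Q / a\<^sup>2)\<bar> \<le> s^6 * (2 * Q * B / a^4 + 2 * norm u * K / a^4)"
      by (simp add: l_def B_def Q_def K_def)
    also have "\<dots> = s^6 * ((2 * Q * B + 2 * norm u * K) / (a\<^sup>2)\<^sup>2)"
      by (simp add: add_divide_distrib)
    also have "\<dots> \<le> s^6 * c"
      unfolding c_def using nonneg la lA elim(2)
      by (intro mult_left_mono divide_left_mono power_mono mult_pos_pos) auto
    also have "\<dots> = s^4 * (s\<^sup>2 * c)" by (simp add: eval_nat_numeral)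
    finally have le: "\<bar>(l - (a\<^sup>2 + s\<^sup>2 * B + s^4 * Q / a\<^sup>2)) / s^4\<bar> \<le> s\<^sup>2 * c"
      using elim(2) by (simp add: field_simps)
    have eq: "?f s = (l - (a\<^sup>2 + s\<^sup>2 * B + s^4 * Q / a\<^sup>2)) / s^4"
      unfolding a_def[symmetric] l_def[symmetric] a2[symmetric] B_def[symmetric]
        BC[folded B_def Q_def]
      by (simp only: mult_ac add_ac times_divide_eq_left times_divide_eq_right)
    show ?case unfolding eq real_norm_def by (rule le)
  qed
  moreover have "((\<lambda>s::real. s\<^sup>2 * c) \<longlongrightarrow> 0\<^sup>2 * c) (at_right 0)" by (intro tendsto_intros)
  then have "((\<lambda>s::real. s\<^sup>2 * c) \<longlongrightarrow> 0) (at_right 0)" by simp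
  ultimately show ?thesis by (rule Lim_null_comparison)
qed

subsection \<open>Rotation invariance of the standard normal law\<close>

abbreviation std_normal :: "real measure" where
  "std_normal \<equiv> density lborel std_normal_density"

definition std_normal_vec :: "(real^'m) measure" where
  "std_normal_vec = distr (PiM UNIV (\<lambda>_. std_normal)) borel (\<lambda>g. \<chi> j. g j)"

lemma prob_space_std_normal: "prob_space std_normal"
  by (simp add: prob_space_normal_density)

lemma borel_measurable_vec_nth_iff:
  fixes f :: "'a \<Rightarrow> 'b::euclidean_space^'n"
  shows "f \<in> borel_measurable M \<longleftrightarrow> (\<forall>i. (\<lambda>x. f x $ i) \<in> borel_measurable M)"
proof
  assume f: "f \<in> borel_measurable M"
  have "(\<lambda>x::'b^'n. x $ i) \<in> borel_measurable borel" for i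
    by (intro borel_measurable_continuous_onI continuous_intros)
  with f show "\<forall>i. (\<lambda>x. f x $ i) \<in> borel_measurable M"
    by (auto intro: measurable_compose)
next
  assume "\<forall>i. (\<lambda>x. f x $ i) \<in> borel_measurable M"
  then show "f \<in> borel_measurable M"
    by (subst borel_measurable_euclidean_space) (auto simp: Basis_vec_def inner_axis intro!: borel_measurable_inner)
qed

lemma measurable_vec_lambda_PiM [measurable]:
  "(\<lambda>g. (\<chi> j. g j) :: real^'m) \<in> borel_measurable (PiM UNIV (\<lambda>_. std_normal))"
  unfolding borel_measurable_vec_nth_iff by measurable

lemma prob_space_PiM_const: "prob_space M \<Longrightarrow> prob_space (PiM I (\<lambda>_. M))"
  by (rule prob_space_PiM)

lemma prob_space_std_normal_vec: "prob_space std_normal_vec"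
  unfolding std_normal_vec_def
  by (intro prob_space.prob_space_distr prob_space_PiM_const prob_space_std_normal) measurable

lemma sets_std_normal_vec [simp, measurable_cong]: "sets std_normal_vec = sets borel"
  by (simp add: std_normal_vec_def)

lemma product_sigma_finite_const: "prob_space M \<Longrightarrow> product_sigma_finite (\<lambda>_. M)"
  by (simp add: product_sigma_finite_def prob_space_imp_sigma_finite)

section \<open>Zipping product measures\<close>

lemma emeasure_distr_nn_integral:
  assumes "f \<in> measurable M N" "X \<in> sets N"
  shows "emeasure (distr M N f) X = (\<integral>\<^sup>+x. indicator X (f x) \<partial>M)"
proof -
  have "emeasure (distr M N f) X = (\<integral>\<^sup>+y. indicator X y \<partial>distr M N f)"
    using assms by simp
  also have "\<dots> = (\<integral>\<^sup>+x. indicator X (f x) \<partial>M)"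
    using assms by (intro nn_integral_distr) auto
  finally show ?thesis .
qed

text \<open>Both measures are compared on boxes, where the indicator factors over the coordinates
  and Fubini turns each factor into a measure on pairs. This serves to rotate pairs of vectors
  coordinate by coordinate and to separate spike coefficients from noise in a sample.\<close>

lemma distr_PiM_zip:
  assumes I: "finite I" and M: "prob_space M" and N: "prob_space N"
  shows "distr (PiM I (\<lambda>_. M) \<Otimes>\<^sub>M PiM I (\<lambda>_. N)) (PiM I (\<lambda>_. M \<Otimes>\<^sub>M N)) (\<lambda>(x, y). \<lambda>i\<in>I. (x i, y i))
    = PiM I (\<lambda>_. M \<Otimes>\<^sub>M N)"
proof -
  interpret M: prob_space M by fact
  interpret N: prob_space N by fact
  interpret MN: pair_prob_space M N ..
  interpret PM: product_sigma_finite "\<lambda>_. M" by (rule product_sigma_finite_const) fact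
  interpret PN: product_sigma_finite "\<lambda>_. N" by (rule product_sigma_finite_const) fact
  interpret P: product_sigma_finite "\<lambda>_. M \<Otimes>\<^sub>M N"
    by (rule product_sigma_finite_const) unfold_locales
  interpret Q: prob_space "PiM I (\<lambda>_. N)" by (intro prob_space_PiM_const N)
  show ?thesis
  proof (rule P.PiM_eqI[OF I])
    fix A assume A: "\<And>i. i \<in> I \<Longrightarrow> A i \<in> sets (M \<Otimes>\<^sub>M N)"
    let ?D = "PiM I (\<lambda>_. M) \<Otimes>\<^sub>M PiM I (\<lambda>_. N)"
    have [measurable]: "(\<lambda>(x, y). \<lambda>i\<in>I. (x i, y i)) \<in> measurable ?D (PiM I (\<lambda>_. M \<Otimes>\<^sub>M N))"
      by measurable
    have PA: "Pi\<^sub>E I A \<in> sets (PiM I (\<lambda>_. M \<Otimes>\<^sub>M N))"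
      using A I by (intro sets_PiM_I_finite) auto
    have indA: "(\<lambda>p. indicator (A i) p :: ennreal) \<in> borel_measurable (M \<Otimes>\<^sub>M N)" if "i \<in> I" for i
      using A[OF that] by measurable
    have indA2: "(\<lambda>x. \<integral>\<^sup>+y. indicator (A i) (x, y) \<partial>N) \<in> borel_measurable M" if "i \<in> I" for i
      using N.borel_measurable_nn_integral_fst[OF indA[OF that]] .
    have "emeasure (distr ?D (PiM I (\<lambda>_. M \<Otimes>\<^sub>M N)) (\<lambda>(x, y). \<lambda>i\<in>I. (x i, y i))) (Pi\<^sub>E I A)
        = (\<integral>\<^sup>+p. indicator (Pi\<^sub>E I A) (case p of (x, y) \<Rightarrow> \<lambda>i\<in>I. (x i, y i)) \<partial>?D)"
      using PA by (subst emeasure_distr_nn_integral) auto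
    also have "\<dots> = (\<integral>\<^sup>+x. \<integral>\<^sup>+y. indicator (Pi\<^sub>E I A) (\<lambda>i\<in>I. (x i, y i)) \<partial>PiM I (\<lambda>_. N) \<partial>PiM I (\<lambda>_. M))"
      using PA by (subst Q.nn_integral_fst[symmetric]) auto
    also have "\<dots> = (\<integral>\<^sup>+x. \<integral>\<^sup>+y. (\<Prod>i\<in>I. indicator (A i) (x i, y i)) \<partial>PiM I (\<lambda>_. N) \<partial>PiM I (\<lambda>_. M))"
      by (intro nn_integral_cong) (auto simp: indicator_def PiE_iff prod_eq_1_iff extensional_def I split: if_splits)
    also have "\<dots> = (\<integral>\<^sup>+x. (\<Prod>i\<in>I. \<integral>\<^sup>+y. indicator (A i) (x i, y) \<partial>N) \<partial>PiM I (\<lambda>_. M))"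
    proof (intro nn_integral_cong PN.product_nn_integral_prod I)
      fix x i assume "x \<in> space (PiM I (\<lambda>_. M))" "i \<in> I"
      then have "x i \<in> space M" by (auto simp: space_PiM)
      then show "(\<lambda>y. indicator (A i) (x i, y) :: ennreal) \<in> borel_measurable N"
        by (rule measurable_compose[OF measurable_Pair1' indA[OF \<open>i \<in> I\<close>]])
    qed
    also have "\<dots> = (\<Prod>i\<in>I. \<integral>\<^sup>+x. \<integral>\<^sup>+y. indicator (A i) (x, y) \<partial>N \<partial>M)"
      by (intro PM.product_nn_integral_prod I indA2)
    also have "\<dots> = (\<Prod>i\<in>I. emeasure (M \<Otimes>\<^sub>M N) (A i))"
      using A by (intro prod.cong refl) (simp add: N.nn_integral_fst[OF indA])
    finally show "emeasure (distr ?D (PiM I (\<lambda>_. M \<Otimes>\<^sub>M N)) (\<lambda>(x, y). \<lambda>i\<in>I. (x i, y i))) (Pi\<^sub>E I A)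
        = (\<Prod>i\<in>I. emeasure (M \<Otimes>\<^sub>M N) (A i))" .
  qed simp
qed

text \<open>For a fixed value of the other coordinate a shear is a translation, which preserves
  Lebesgue measure. The second identity follows from the first by exchanging the integrals.\<close>

lemma nn_integral_lborel_shear:
  fixes F :: "real \<times> real \<Rightarrow> ennreal"
  assumes [measurable]: "F \<in> borel_measurable (borel \<Otimes>\<^sub>M borel)"
  shows "(\<integral>\<^sup>+x. \<integral>\<^sup>+y. F (x, y + t * x) \<partial>lborel \<partial>lborel) = (\<integral>\<^sup>+x. \<integral>\<^sup>+y. F (x, y) \<partial>lborel \<partial>lborel)"
    and "(\<integral>\<^sup>+x. \<integral>\<^sup>+y. F (x + t * y, y) \<partial>lborel \<partial>lborel) = (\<integral>\<^sup>+x. \<integral>\<^sup>+y. F (x, y) \<partial>lborel \<partial>lborel)"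
proof -
  have *: "(\<integral>\<^sup>+x. \<integral>\<^sup>+y. G (x, y + t * x) \<partial>lborel \<partial>lborel) = (\<integral>\<^sup>+x. \<integral>\<^sup>+y. G (x, y) \<partial>lborel \<partial>lborel)"
    if [measurable]: "G \<in> borel_measurable (borel \<Otimes>\<^sub>M borel)" for G :: "real \<times> real \<Rightarrow> ennreal"
  proof (rule nn_integral_cong)
    fix x :: real
    show "(\<integral>\<^sup>+y. G (x, y + t * x) \<partial>lborel) = (\<integral>\<^sup>+y. G (x, y) \<partial>lborel)"
      using nn_integral_real_affine[of "\<lambda>y. G (x, y)" 1 "t * x"] by (simp add: add.commute)
  qed
  show "(\<integral>\<^sup>+x. \<integral>\<^sup>+y. F (x, y + t * x) \<partial>lborel \<partial>lborel) = (\<integral>\<^sup>+x. \<integral>\<^sup>+y. F (x, y) \<partial>lborel \<partial>lborel)"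
    by (rule *) measurable
  have "(\<integral>\<^sup>+x. \<integral>\<^sup>+y. F (x + t * y, y) \<partial>lborel \<partial>lborel) = (\<integral>\<^sup>+y. \<integral>\<^sup>+x. F (x + t * y, y) \<partial>lborel \<partial>lborel)"
    by (rule lborel_pair.Fubini') measurable
  also have "\<dots> = (\<integral>\<^sup>+y. \<integral>\<^sup>+x. F (x, y) \<partial>lborel \<partial>lborel)"
    using *[of "\<lambda>(x, y). F (y, x)"] by simp
  also have "\<dots> = (\<integral>\<^sup>+x. \<integral>\<^sup>+y. F (x, y) \<partial>lborel \<partial>lborel)"
    by (rule lborel_pair.Fubini') measurable
  finally show "(\<integral>\<^sup>+x. \<integral>\<^sup>+y. F (x + t * y, y) \<partial>lborel \<partial>lborel) = (\<integral>\<^sup>+x. \<integral>\<^sup>+y. F (x, y) \<partial>lborel \<partial>lborel)" .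
qed

text \<open>A plane rotation other than the half turn is a product of three shears.\<close>

lemma nn_integral_lborel_rotation:
  fixes F :: "real \<times> real \<Rightarrow> ennreal"
  assumes [measurable]: "F \<in> borel_measurable (borel \<Otimes>\<^sub>M borel)" and cs: "c\<^sup>2 + s\<^sup>2 = 1" and c: "0 \<le> c"
  shows "(\<integral>\<^sup>+x. \<integral>\<^sup>+y. F (c * x + s * y, c * y - s * x) \<partial>lborel \<partial>lborel) = (\<integral>\<^sup>+x. \<integral>\<^sup>+y. F (x, y) \<partial>lborel \<partial>lborel)"
proof -
  \<comment> \<open>The tangent of half the rotation angle, with \<open>c\<close> as cosine and
    \<open>s\<close> as sine. The rotation is the shear by \<open>t\<close> in the first coordinate,
    then by \<open>- s\<close> in the second, then by \<open>t\<close> in the first again;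
    \<open>0 \<le> c\<close> keeps the denominator positive.\<close>
  define t where "t = s / (1 + c)"
  have ts: "t * s = 1 - c"
    using cs c by (simp add: t_def field_simps power2_eq_square)
  have tc: "t * (1 + c) = s" using c by (simp add: t_def)
  define G where "G = (\<lambda>(x, y). F (x + t * y, y))"
  define H where "H = (\<lambda>(x, y). G (x, y + (- s) * x))"
  have [measurable]: "G \<in> borel_measurable (borel \<Otimes>\<^sub>M borel)" "H \<in> borel_measurable (borel \<Otimes>\<^sub>M borel)"
    unfolding G_def H_def by measurable
  have "F (c * x + s * y, c * y - s * x) = H (x + t * y, y)" for x y
  proof -
    have "c * x + s * y = x + t * y + t * (y - s * (x + t * y))"
    proof -
      have "x + t * y + t * (y - s * (x + t * y)) = (1 - t * s) * x + (t * (1 + (1 - t * s))) * y"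
        by (simp add: algebra_simps)
      then show ?thesis unfolding ts using tc by simp
    qed
    moreover have "c * y - s * x = y - s * (x + t * y)"
    proof -
      have "y - s * (x + t * y) = (1 - t * s) * y - s * x" by (simp add: algebra_simps)
      then show ?thesis unfolding ts by simp
    qed
    ultimately show ?thesis by (simp add: H_def G_def)
  qed
  then have "(\<integral>\<^sup>+x. \<integral>\<^sup>+y. F (c * x + s * y, c * y - s * x) \<partial>lborel \<partial>lborel) = (\<integral>\<^sup>+x. \<integral>\<^sup>+y. H (x + t * y, y) \<partial>lborel \<partial>lborel)"
    by simp
  also have "\<dots> = (\<integral>\<^sup>+x. \<integral>\<^sup>+y. H (x, y) \<partial>lborel \<partial>lborel)" by (rule nn_integral_lborel_shear) measurable
  also have "\<dots> = (\<integral>\<^sup>+x. \<integral>\<^sup>+y. G (x, y) \<partial>lborel \<partial>lborel)"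
    using nn_integral_lborel_shear(1)[of G "- s"] by (simp add: H_def)
  also have "\<dots> = (\<integral>\<^sup>+x. \<integral>\<^sup>+y. F (x, y) \<partial>lborel \<partial>lborel)"
    using nn_integral_lborel_shear(2)[of F t] by (simp add: G_def)
  finally show ?thesis .
qed

text \<open>The joint density depends only on \<open>x\<^sup>2 + y\<^sup>2\<close>, which a rotation
  preserves, and Lebesgue measure is preserved as well.\<close>

lemma distr_std_normal_rotation:
  assumes cs: "c\<^sup>2 + s\<^sup>2 = 1" and c: "0 \<le> c"
  shows "distr (std_normal \<Otimes>\<^sub>M std_normal) (std_normal \<Otimes>\<^sub>M std_normal) (\<lambda>(x, y). (c * x + s * y, c * y - s * x))
    = std_normal \<Otimes>\<^sub>M std_normal"
proof (rule measure_eqI)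
  let ?R = "\<lambda>(x, y). (c * x + s * y, c * y - s * x)" and ?P = "std_normal \<Otimes>\<^sub>M std_normal"
  interpret prob_space std_normal by (rule prob_space_std_normal)
  have [measurable]: "?R \<in> measurable ?P ?P" by measurable
  fix X assume "X \<in> sets (distr ?P ?P ?R)"
  then have X: "X \<in> sets ?P" by simp
  have sP: "sets ?P = sets (borel \<Otimes>\<^sub>M borel)" by (intro sets_pair_measure_cong) simp_all
  define f :: "real \<times> real \<Rightarrow> ennreal" where "f = indicator X"
  have [measurable]: "f \<in> borel_measurable (borel \<Otimes>\<^sub>M borel)"
    unfolding f_def using X sP by (intro borel_measurable_indicator) simp
  have [measurable]: "f \<in> borel_measurable ?P"
    unfolding f_def using X by (intro borel_measurable_indicator)
  define F where "F = (\<lambda>(x, y). ennreal (std_normal_density x) * (ennreal (std_normal_density y) * f (x, y)))"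
  have [measurable]: "F \<in> borel_measurable (borel \<Otimes>\<^sub>M borel)" unfolding F_def by measurable
  have *: "(\<integral>\<^sup>+x. \<integral>\<^sup>+y. g (x, y) \<partial>std_normal \<partial>std_normal)
      = (\<integral>\<^sup>+x. \<integral>\<^sup>+y. ennreal (std_normal_density x) * (ennreal (std_normal_density y) * g (x, y)) \<partial>lborel \<partial>lborel)"
    if [measurable]: "g \<in> borel_measurable (borel \<Otimes>\<^sub>M borel)" for g
    by (simp add: nn_integral_density nn_integral_cmult)
  have rot: "std_normal_density x * std_normal_density y
      = std_normal_density (c * x + s * y) * std_normal_density (c * y - s * x)" for x y
  proof -
    have "(c * x + s * y)\<^sup>2 + (c * y - s * x)\<^sup>2 = (c\<^sup>2 + s\<^sup>2) * (x\<^sup>2 + y\<^sup>2)"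
      by (simp add: power2_eq_square algebra_simps)
    then have "- (x\<^sup>2 / 2) + - (y\<^sup>2 / 2) = - ((c * x + s * y)\<^sup>2 / 2) + - ((c * y - s * x)\<^sup>2 / 2)"
      using cs by simp
    then show ?thesis
      by (simp add: std_normal_density_def exp_add[symmetric] del: minus_add_distrib)
  qed
  have rotF: "ennreal (std_normal_density x) * (ennreal (std_normal_density y) * f (c * x + s * y, c * y - s * x))
      = F (c * x + s * y, c * y - s * x)" for x y
    unfolding F_def prod.case mult.assoc[symmetric]
    by (simp only: ennreal_mult[OF normal_density_nonneg normal_density_nonneg, symmetric] rot[of x y])
  have "emeasure (distr ?P ?P ?R) X = (\<integral>\<^sup>+p. f (?R p) \<partial>?P)"
    using X by (subst emeasure_distr_nn_integral) (auto simp: f_def)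
  also have "\<dots> = (\<integral>\<^sup>+x. \<integral>\<^sup>+y. f (?R (x, y)) \<partial>std_normal \<partial>std_normal)"
    by (subst nn_integral_fst[symmetric]) auto
  also have "\<dots> = (\<integral>\<^sup>+x. \<integral>\<^sup>+y. F (c * x + s * y, c * y - s * x) \<partial>lborel \<partial>lborel)"
    using *[of "\<lambda>p. f (?R p)"] by (simp only: rotF prod.case) measurable
  also have "\<dots> = (\<integral>\<^sup>+x. \<integral>\<^sup>+y. F (x, y) \<partial>lborel \<partial>lborel)"
    by (rule nn_integral_lborel_rotation[OF _ cs c]) measurable
  also have "\<dots> = (\<integral>\<^sup>+x. \<integral>\<^sup>+y. f (x, y) \<partial>std_normal \<partial>std_normal)"
    by (subst *) (simp_all add: F_def)
  also have "\<dots> = emeasure ?P X"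
    using X by (subst nn_integral_fst) (simp_all add: f_def)
  finally show "emeasure (distr ?P ?P ?R) X = emeasure ?P X" .
qed simp

text \<open>Two independent normal vectors form a family of independent pairs of coordinates, and
  the same plane rotation acts on each pair. Iterated integrals of nonnegative functions express the
  equality of laws in the form needed for later conditioning.\<close>

lemma nn_integral_std_normal_vec_rotation:
  fixes f :: "(real^'m) \<times> (real^'m) \<Rightarrow> ennreal"
  assumes [measurable]: "f \<in> borel_measurable (borel \<Otimes>\<^sub>M borel)" and cs: "c\<^sup>2 + s\<^sup>2 = 1" and c: "0 \<le> c"
  shows "(\<integral>\<^sup>+y. \<integral>\<^sup>+z. f (c *\<^sub>R y + s *\<^sub>R z, c *\<^sub>R z - s *\<^sub>R y) \<partial>std_normal_vec \<partial>std_normal_vec)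
    = (\<integral>\<^sup>+y. \<integral>\<^sup>+z. f (y, z) \<partial>std_normal_vec \<partial>std_normal_vec)"
proof -
  let ?N = "std_normal \<Otimes>\<^sub>M std_normal" and ?P = "PiM (UNIV::'m set) (\<lambda>_. std_normal)"
  let ?R = "\<lambda>(x, y). (c * x + s * y, c * y - s * x)"
  interpret N: prob_space std_normal by (rule prob_space_std_normal)
  interpret NN: pair_prob_space std_normal std_normal ..
  interpret P: prob_space ?P by (intro prob_space_PiM_const prob_space_std_normal)
  let ?Q = "PiM (UNIV::'m set) (\<lambda>_. ?N)"
  have zip: "(\<integral>\<^sup>+y. \<integral>\<^sup>+z. g (y, z) \<partial>std_normal_vec \<partial>std_normal_vec)
      = (\<integral>\<^sup>+p. g (\<chi> j. fst (p j), \<chi> j. snd (p j)) \<partial>?Q)"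
    if [measurable]: "g \<in> borel_measurable (borel \<Otimes>\<^sub>M borel)" for g :: "(real^'m) \<times> (real^'m) \<Rightarrow> ennreal"
  proof -
    interpret G: prob_space "std_normal_vec :: (real^'m) measure" by (rule prob_space_std_normal_vec)
    have [measurable]: "(\<lambda>p. (\<chi> j. fst (p j), \<chi> j. snd (p j)) :: (real^'m) \<times> (real^'m)) \<in> measurable ?Q (borel \<Otimes>\<^sub>M borel)"
      by (intro measurable_Pair) (simp_all only: borel_measurable_vec_nth_iff vec_lambda_beta, measurable)
    have "(\<integral>\<^sup>+y. \<integral>\<^sup>+z. g (y, z) \<partial>std_normal_vec \<partial>std_normal_vec)
        = (\<integral>\<^sup>+y. \<integral>\<^sup>+z. g (y, \<chi> j. z j) \<partial>?P \<partial>std_normal_vec)"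
      unfolding std_normal_vec_def by (intro nn_integral_cong nn_integral_distr) (auto simp: space_distr)
    also have "\<dots> = (\<integral>\<^sup>+y. \<integral>\<^sup>+z. g (\<chi> j. y j, \<chi> j. z j) \<partial>?P \<partial>?P)"
      unfolding std_normal_vec_def by (subst nn_integral_distr) auto
    also have "\<dots> = (\<integral>\<^sup>+q. g (\<chi> j. fst q j, \<chi> j. snd q j) \<partial>(?P \<Otimes>\<^sub>M ?P))"
      by (subst P.nn_integral_fst[symmetric]) auto
    also have "\<dots> = (\<integral>\<^sup>+p. g (\<chi> j. fst (p j), \<chi> j. snd (p j)) \<partial>distr (?P \<Otimes>\<^sub>M ?P) ?Q (\<lambda>(x, y). \<lambda>i\<in>UNIV. (x i, y i)))"
      by (subst nn_integral_distr) (auto simp: case_prod_beta)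
    also have "\<dots> = (\<integral>\<^sup>+p. g (\<chi> j. fst (p j), \<chi> j. snd (p j)) \<partial>?Q)"
      by (subst distr_PiM_zip) (auto intro: prob_space_std_normal)
    finally show ?thesis .
  qed
  have NP: "prob_space ?N" by (rule NN.P.prob_space_axioms)
  have R [measurable]: "?R \<in> measurable ?N ?N" by measurable
  have RQ: "distr ?Q ?Q (compose UNIV ?R) = ?Q"
    using distr_PiM_finite_prob_space'[of "UNIV::'m set" "\<lambda>_. ?N" "\<lambda>_. ?N" ?R] NP R
    by (simp add: distr_std_normal_rotation[OF cs c])
  have Rm: "compose UNIV ?R \<in> measurable ?Q ?Q" unfolding compose_def by measurable
  have [measurable]: "(\<lambda>p. f (\<chi> j. fst (p j), \<chi> j. snd (p j))) \<in> borel_measurable ?Q"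
  proof (rule measurable_compose[OF _ assms(1)])
    show "(\<lambda>p. (\<chi> j. fst (p j), \<chi> j. snd (p j)) :: (real^'m) \<times> (real^'m)) \<in> measurable ?Q (borel \<Otimes>\<^sub>M borel)"
      by (intro measurable_Pair) (simp_all only: borel_measurable_vec_nth_iff vec_lambda_beta, measurable)
  qed
  have "(\<integral>\<^sup>+y. \<integral>\<^sup>+z. f (c *\<^sub>R y + s *\<^sub>R z, c *\<^sub>R z - s *\<^sub>R y) \<partial>std_normal_vec \<partial>std_normal_vec)
      = (\<integral>\<^sup>+p. f (c *\<^sub>R (\<chi> j. fst (p j)) + s *\<^sub>R (\<chi> j. snd (p j)), c *\<^sub>R (\<chi> j. snd (p j)) - s *\<^sub>R (\<chi> j. fst (p j))) \<partial>?Q)"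
    using zip[of "\<lambda>(y, z). f (c *\<^sub>R y + s *\<^sub>R z, c *\<^sub>R z - s *\<^sub>R y)"] by simp
  also have "\<dots> = (\<integral>\<^sup>+p. f (\<chi> j. fst (compose UNIV ?R p j), \<chi> j. snd (compose UNIV ?R p j)) \<partial>?Q)"
    by (intro nn_integral_cong arg_cong[where f=f] prod_eqI) (simp_all add: vec_eq_iff compose_def case_prod_beta)
  also have "\<dots> = (\<integral>\<^sup>+p. f (\<chi> j. fst (p j), \<chi> j. snd (p j)) \<partial>distr ?Q ?Q (compose UNIV ?R))"
    by (subst nn_integral_distr[OF Rm]) simp_all
  also have "\<dots> = (\<integral>\<^sup>+y. \<integral>\<^sup>+z. f (y, z) \<partial>std_normal_vec \<partial>std_normal_vec)"
    unfolding RQ by (rule zip[symmetric]) measurable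
  finally show ?thesis .
qed

subsection \<open>Linear and quadratic functions of normal vectors\<close>

lemma prob_space_centered_normal:
  assumes "0 \<le> a" shows "prob_space (centered_normal a)"
  using assms by (auto simp: centered_normal_def intro!: prob_space_return prob_space_normal_density)

lemma sets_centered_normal [simp, measurable_cong]: "sets (centered_normal a) = sets borel"
  by (simp add: centered_normal_def)

lemma centered_normal_1: "centered_normal 1 = std_normal"
  by (simp add: centered_normal_def)

lemma distr_std_normal_mult: "distr std_normal borel (\<lambda>x. c * x) = centered_normal (c\<^sup>2)"
proof (cases "c = 0")
  case True
  then show ?thesis
    using prob_space.distr_const[OF prob_space_std_normal, of "0::real" borel] by (simp add: centered_normal_def)
next
  case False
  interpret prob_space std_normal by (rule prob_space_std_normal)
  have "distributed std_normal lborel (\<lambda>x. x) (normal_density 0 1)"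
    unfolding distributed_def by (auto intro!: measure_eqI simp: emeasure_distr)
  from normal_density_affine[OF this _ False, of 0]
  have "distr std_normal lborel (\<lambda>x. c * x) = density lborel (normal_density 0 \<bar>c\<bar>)"
    by (simp add: distributed_def)
  moreover have "distr std_normal borel (\<lambda>x. c * x) = distr std_normal lborel (\<lambda>x. c * x)"
    by (rule distr_cong) auto
  ultimately show ?thesis using False by (simp add: centered_normal_def)
qed

text \<open>Covers the degenerate variances: linear functionals of a normal vector may have variance
  0, where no density is available.\<close>

lemma convolution_return_0:
  fixes M :: "real measure"
  assumes [simp]: "sets M = sets borel" and M: "prob_space M"
  shows "return borel 0 \<star> M = M" "M \<star> return borel 0 = M"
proof -
  have fin: "finite_measure M" "finite_measure (return borel (0::real))"
    using M prob_space_return[of "0::real" borel] by (simp_all add: prob_space_def)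
  show *: "return borel 0 \<star> M = M"
  proof (rule measure_eqI)
    fix X assume "X \<in> sets (return borel 0 \<star> M)"
    then have [measurable]: "X \<in> sets borel" by simp
    have [measurable_cong]: "sets M = sets borel" by simp
    interpret M: prob_space M by fact
    have "emeasure (return borel 0 \<star> M) X = (\<integral>\<^sup>+x. \<integral>\<^sup>+y. indicator X (x + y) \<partial>M \<partial>return borel 0)"
      by (intro convolution_emeasure' fin) simp_all
    also have "\<dots> = emeasure M X"
      by (subst nn_integral_return) auto
    finally show "emeasure (return borel 0 \<star> M) X = emeasure M X" .
  qed simp
  then show "M \<star> return borel 0 = M"
    using convolution_commutative[OF fin] by simp
qed

lemma convolution_centered_normal:
  assumes "0 \<le> a" "0 \<le> b"
  shows "centered_normal a \<star> centered_normal b = centered_normal (a + b)"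
proof (cases "a = 0 \<or> b = 0")
  case True
  then show ?thesis
    using convolution_return_0[OF sets_centered_normal prob_space_centered_normal] assms
    by (auto simp: centered_normal_def[of 0])
next
  case False
  then have ab: "0 < a" "0 < b" using assms by auto
  have "finite_measure (density lborel (normal_density 0 (sqrt c)))" if "0 < c" for c
    using prob_space_normal_density[of "sqrt c" 0] that by (simp add: prob_space_def)
  with ab show ?thesis
    using conv_normal_density_zero_mean[of "sqrt a" "sqrt b"]
    by (simp add: centered_normal_def convolution_density ennreal_mult' normal_density_nonneg)
qed

lemma distr_pair_sum:
  fixes f :: "'a \<Rightarrow> real" and g :: "'b \<Rightarrow> real"
  assumes [measurable]: "f \<in> borel_measurable M" "g \<in> borel_measurable N" and N: "prob_space N"
  shows "distr (M \<Otimes>\<^sub>M N) borel (\<lambda>(x, y). f x + g y) = (distr M borel f \<star> distr N borel g)"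
proof -
  have "sigma_finite_measure (distr N borel g)"
    by (intro prob_space_imp_sigma_finite prob_space.prob_space_distr N) measurable
  then have "(distr M borel f \<star> distr N borel g)
      = distr (distr (M \<Otimes>\<^sub>M N) (borel \<Otimes>\<^sub>M borel) (\<lambda>(x, y). (f x, g y))) borel (\<lambda>(x, y). x + y)"
    unfolding convolution_def by (subst pair_measure_distr) auto
  also have "\<dots> = distr (M \<Otimes>\<^sub>M N) borel (\<lambda>(x, y). f x + g y)"
    by (subst distr_distr) (auto intro!: distr_cong simp: comp_def case_prod_beta)
  finally show ?thesis ..
qed

text \<open>Induction on the index set: splitting off one coordinate makes the law a convolution,
  and the variances add.\<close>

lemma distr_PiM_linear_combination:
  assumes "finite I"
  shows "distr (PiM I (\<lambda>_. std_normal)) borel (\<lambda>g. \<Sum>i\<in>I. c i * g i) = centered_normal (\<Sum>i\<in>I. (c i)\<^sup>2)"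
  using assms
proof (induction I)
  case empty
  show ?case
    using prob_space.distr_const[OF prob_space_PiM_const[OF prob_space_std_normal], of "0::real" borel]
    by (simp add: centered_normal_def)
next
  case (insert i I)
  have "distr (PiM (insert i I) (\<lambda>_. std_normal)) borel (\<lambda>g. \<Sum>i\<in>insert i I. c i * g i)
      = distr (distr (std_normal \<Otimes>\<^sub>M PiM I (\<lambda>_. std_normal)) (PiM (insert i I) (\<lambda>_. std_normal)) (\<lambda>(x, X). X(i := x)))
          borel (\<lambda>g. \<Sum>i\<in>insert i I. c i * g i)"
    by (subst distr_pair_PiM_eq_PiM) (auto intro: prob_space_std_normal)
  also have "\<dots> = distr (std_normal \<Otimes>\<^sub>M PiM I (\<lambda>_. std_normal)) borel (\<lambda>(x, g). c i * x + (\<Sum>i\<in>I. c i * g i))"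
    using insert by (subst distr_distr) (auto intro!: distr_cong sum.cong simp: comp_def case_prod_beta)
  also have "\<dots> = (centered_normal ((c i)\<^sup>2) \<star> centered_normal (\<Sum>i\<in>I. (c i)\<^sup>2))"
    using insert by (subst distr_pair_sum)
      (auto simp: distr_std_normal_mult intro: prob_space_PiM_const prob_space_std_normal)
  also have "\<dots> = centered_normal (\<Sum>i\<in>insert i I. (c i)\<^sup>2)"
    using insert by (subst convolution_centered_normal) (auto intro: sum_nonneg)
  finally show ?case .
qed

lemma distr_std_normal_vec_inner:
  "distr std_normal_vec borel (\<lambda>z. u \<bullet> z) = centered_normal (u \<bullet> u)"
proof -
  have "distr std_normal_vec borel (\<lambda>z. u \<bullet> z)
      = distr (PiM UNIV (\<lambda>_. std_normal)) borel (\<lambda>g. \<Sum>j\<in>UNIV. u $ j * g j)"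
    unfolding std_normal_vec_def by (subst distr_distr) (auto simp: comp_def inner_vec_def)
  then show ?thesis
    by (simp add: distr_PiM_linear_combination inner_vec_def power2_eq_square)
qed

section \<open>Chi-squared laws of sums of squares\<close>

lemma prob_space_chi_squared: "prob_space (chi_squared k)"
  unfolding chi_squared_def
  by (intro prob_space.prob_space_distr prob_space_PiM_const prob_space_std_normal) measurable

lemma sets_chi_squared [simp, measurable_cong]: "sets (chi_squared k) = sets borel"
  by (simp add: chi_squared_def)

text \<open>A bijection from \<open>{..<card J}\<close> onto \<open>J\<close> transports the product
  measure. With \<open>J\<close> missing one coordinate this supplies the
  \<open>CARD('m) - 1\<close> degrees of freedom.\<close>

lemma distr_std_normal_vec_chi_squared:
  fixes J :: "'m::finite set"
  shows "distr (std_normal_vec :: (real^'m) measure) borel (\<lambda>y. \<Sum>j\<in>J. (y $ j)\<^sup>2) = chi_squared (card J)"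
proof -
  obtain h where h: "bij_betw h {..<card J} J"
    using ex_bij_betw_nat_finite[of J] by (auto simp: atLeast0LessThan)
  have "chi_squared (card J)
      = distr (distr (PiM UNIV (\<lambda>_. std_normal)) (PiM {..<card J} (\<lambda>_. std_normal)) (\<lambda>\<omega>. \<lambda>n\<in>{..<card J}. \<omega> (h n)))
          borel (\<lambda>z. \<Sum>i<card J. (z i)\<^sup>2)"
    unfolding chi_squared_def using h
    by (subst distr_PiM_reindex[where M="\<lambda>_. std_normal"]) (auto simp: bij_betw_def prob_space_std_normal)
  also have "\<dots> = distr (PiM UNIV (\<lambda>_. std_normal)) borel (\<lambda>\<omega>. \<Sum>i<card J. (\<omega> (h i))\<^sup>2)"
    by (subst distr_distr) (auto simp: comp_def)
  also have "(\<lambda>\<omega>::'m \<Rightarrow> real. \<Sum>i<card J. (\<omega> (h i))\<^sup>2) = (\<lambda>\<omega>. \<Sum>j\<in>J. (\<omega> j)\<^sup>2)"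
    by (intro ext sum.reindex_bij_betw[OF h])
  also have "distr (PiM UNIV (\<lambda>_. std_normal)) borel (\<lambda>\<omega>::'m \<Rightarrow> real. \<Sum>j\<in>J. (\<omega> j)\<^sup>2)
      = distr (std_normal_vec :: (real^'m) measure) borel (\<lambda>y. \<Sum>j\<in>J. (y $ j)\<^sup>2)"
    unfolding std_normal_vec_def by (subst distr_distr) (auto simp: comp_def)
  finally show ?thesis ..
qed

text \<open>The projections on a unit vector are independent standard normals. That the law does not
  depend on \<open>d\<close> is the source of the independence of \<open>C\<close> from the
  direction that defines it.\<close>

lemma distr_PiM_std_normal_vec_chi_squared:
  fixes d :: "real^'m"
  assumes d: "d \<bullet> d = 1"
  shows "distr (PiM {..<r} (\<lambda>_. std_normal_vec)) borel (\<lambda>\<omega>. \<Sum>i<r. (d \<bullet> \<omega> i)\<^sup>2) = chi_squared r"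
proof -
  let ?S = "PiM {..<r} (\<lambda>_. std_normal)" and ?G = "std_normal_vec :: (real^'m) measure"
  have D: "distr ?G std_normal (\<lambda>z. d \<bullet> z) = std_normal"
  proof -
    have "distr ?G std_normal (\<lambda>z. d \<bullet> z) = distr ?G borel (\<lambda>z. d \<bullet> z)" by (rule distr_cong) auto
    then show ?thesis by (simp add: distr_std_normal_vec_inner d centered_normal_1)
  qed
  have m [measurable]: "(\<lambda>z. d \<bullet> z) \<in> measurable ?G std_normal" by measurable
  have "?S = distr (PiM {..<r} (\<lambda>_. ?G)) ?S (compose {..<r} (\<lambda>z. d \<bullet> z))"
    using distr_PiM_finite_prob_space'[of "{..<r}" "\<lambda>_. ?G" "\<lambda>_. std_normal" "\<lambda>z. d \<bullet> z"]
      m prob_space_std_normal prob_space_std_normal_vec[where 'a='m] by (simp add: D)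
  then have "chi_squared r = distr (distr (PiM {..<r} (\<lambda>_. ?G)) ?S (compose {..<r} (\<lambda>z. d \<bullet> z))) borel (\<lambda>z. \<Sum>i<r. (z i)\<^sup>2)"
    unfolding chi_squared_def by simp
  also have "\<dots> = distr (PiM {..<r} (\<lambda>_. ?G)) borel (\<lambda>\<omega>. \<Sum>i<r. (d \<bullet> \<omega> i)\<^sup>2)"
  proof (subst distr_distr)
    show "compose {..<r} (\<lambda>z. d \<bullet> z) \<in> measurable (PiM {..<r} (\<lambda>_. ?G)) ?S"
      unfolding compose_def by measurable
  qed (auto simp: comp_def compose_def)
  finally show ?thesis ..
qed

text \<open>With at least one degree of freedom the first coordinate is almost surely nonzero. This
  discards the sample points at which the expansion would divide by zero.\<close>

lemma AE_chi_squared_pos: "AE a in chi_squared (Suc r). 0 < a"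
proof -
  have "AE x in std_normal. x \<noteq> 0"
    using AE_lborel_singleton[of "0::real"] by (subst AE_density) auto
  then have "AE \<omega> in PiM {..<Suc r} (\<lambda>_. std_normal). \<omega> 0 \<noteq> 0"
    by (intro AE_PiM_component[where i=0]) (auto intro: prob_space_std_normal)
  then have "AE \<omega> in PiM {..<Suc r} (\<lambda>_. std_normal). 0 < (\<Sum>i<Suc r. (\<omega> i)\<^sup>2)"
    by eventually_elim (intro sum_pos2[where i=0], auto)
  then show ?thesis unfolding chi_squared_def by (subst AE_distr_iff) auto
qed

subsection \<open>The law of the Gram matrix\<close>

lemma borel_measurable_outer [measurable (raw)]:
  fixes f :: "'a \<Rightarrow> real^'m"
  assumes [measurable]: "f \<in> borel_measurable M"
  shows "(\<lambda>x. outer (f x)) \<in> borel_measurable M"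
proof -
  have "(\<lambda>x. f x $ i) \<in> borel_measurable M" for i
    using assms by (simp add: borel_measurable_vec_nth_iff)
  then have "(\<lambda>x. outer (f x) $ i $ j) \<in> borel_measurable M" for i j
    unfolding outer_def vec_lambda_beta by measurable
  then show ?thesis unfolding borel_measurable_vec_nth_iff[of "\<lambda>x. outer (f x)"]
    by (subst borel_measurable_vec_nth_iff) blast
qed

lemma borel_measurable_spiked_gram [measurable (raw)]:
  fixes p u :: "'a \<Rightarrow> real^'m"
  assumes [measurable]: "p \<in> borel_measurable M" "u \<in> borel_measurable M" "\<And>i. i < r \<Longrightarrow> (\<lambda>x. w x i) \<in> borel_measurable M"
  shows "(\<lambda>x. spiked_gram (p x) (u x) (w x) r) \<in> borel_measurable M"
  unfolding spiked_gram_def by measurable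

lemma borel_measurable_linear:
  fixes L :: "'a::euclidean_space \<Rightarrow> 'b::euclidean_space"
  assumes "linear L"
  shows "L \<in> borel_measurable borel"
  using assms
  by (intro borel_measurable_continuous_onI linear_continuous_on) (simp add: linear_conv_bounded_linear)

lemma outer_minus: "outer (- p) = outer p"
  by (simp add: outer_def)

text \<open>Writing the two vectors as columns of a matrix, the sum of outer products is that matrix
  times its transpose, and an orthogonal factor on the right cancels.\<close>

lemma outer_rotation:
  assumes "c\<^sup>2 + s\<^sup>2 = 1"
  shows "outer (c *\<^sub>R p + s *\<^sub>R q) + outer (c *\<^sub>R q - s *\<^sub>R p) = outer p + outer q"
proof -
  have "(c * a + s * b) * (c * a' + s * b') + (c * b - s * a) * (c * b' - s * a')
      = (c\<^sup>2 + s\<^sup>2) * (a * a' + b * b')" for a b a' b'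
    by (simp add: power2_eq_square algebra_simps)
  with assms show ?thesis by (simp add: vec_eq_iff outer_def)
qed

text \<open>The rotation sends the spike coefficients \<open>(a, x)\<close> to
  \<open>(a', 0)\<close>. The second vector thereby becomes pure noise and is stored at the new
  index \<open>r\<close>.\<close>

lemma spiked_gram_add_outer:
  assumes L: "linear L" and cs: "c\<^sup>2 + s\<^sup>2 = 1" and "c * a + s * x = a'" "c * x = s * a"
  shows "spiked_gram (a *\<^sub>R p) (L y) (\<lambda>i. L (w i)) r + outer (x *\<^sub>R p + L z)
    = spiked_gram (a' *\<^sub>R p) (L (c *\<^sub>R y + s *\<^sub>R z)) (\<lambda>i. L ((w(r := c *\<^sub>R z - s *\<^sub>R y)) i)) (Suc r)"
proof -
  have "c *\<^sub>R (a *\<^sub>R p + L y) + s *\<^sub>R (x *\<^sub>R p + L z) = a' *\<^sub>R p + L (c *\<^sub>R y + s *\<^sub>R z)"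
    using assms(3) by (simp add: linear_add[OF L] linear_cmul[OF L] algebra_simps flip: scaleR_add_left)
  moreover have "c *\<^sub>R (x *\<^sub>R p + L z) - s *\<^sub>R (a *\<^sub>R p + L y) = L (c *\<^sub>R z - s *\<^sub>R y)"
    using assms(4) by (simp add: linear_diff[OF L] linear_cmul[OF L] algebra_simps)
  ultimately have "outer (a *\<^sub>R p + L y) + outer (x *\<^sub>R p + L z)
      = outer (a' *\<^sub>R p + L (c *\<^sub>R y + s *\<^sub>R z)) + outer (L (c *\<^sub>R z - s *\<^sub>R y))"
    using outer_rotation[OF cs, of "a *\<^sub>R p + L y" "x *\<^sub>R p + L z"] by simp
  then show ?thesis by (simp add: spiked_gram_def add_ac)
qed

text \<open>A quarter turn of two independent normal vectors, applied to a function of the second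
  one only.\<close>

lemma nn_integral_std_normal_vec_uminus:
  fixes h :: "real^'m \<Rightarrow> ennreal"
  assumes [measurable]: "h \<in> borel_measurable borel"
  shows "(\<integral>\<^sup>+y. h (- y) \<partial>std_normal_vec) = (\<integral>\<^sup>+y. h y \<partial>std_normal_vec)"
proof -
  interpret prob_space "std_normal_vec :: (real^'m) measure" by (rule prob_space_std_normal_vec)
  show ?thesis
    using nn_integral_std_normal_vec_rotation[of "\<lambda>(y, z). h z" 0 1]
    by (simp add: emeasure_space_1)
qed

text \<open>Induction on the sample size: the vectors treated so far carry one common spike
  coefficient, and each new vector is rotated against the carrier so that its own coefficient moves
  there. The law of the noise survives by rotation invariance.\<close>

lemma nn_integral_gram_eq_spiked_gram:
  fixes L :: "real^'m \<Rightarrow> real^'m" and p :: "real^'m" and f :: "real^'m^'m \<Rightarrow> ennreal" and x :: "nat \<Rightarrow> real"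
  assumes L: "linear L" and [measurable]: "f \<in> borel_measurable borel"
  shows "(\<integral>\<^sup>+w. f (\<Sum>i<Suc r. outer (x i *\<^sub>R p + L (w i))) \<partial>PiM {..<Suc r} (\<lambda>_. std_normal_vec))
    = (\<integral>\<^sup>+y. \<integral>\<^sup>+w. f (spiked_gram (sqrt (\<Sum>i<Suc r. (x i)\<^sup>2) *\<^sub>R p) (L y) (\<lambda>i. L (w i)) r)
        \<partial>PiM {..<r} (\<lambda>_. std_normal_vec) \<partial>std_normal_vec)"
  using assms(2)
proof (induction r arbitrary: f)
  case 0
  let ?G = "std_normal_vec :: (real^'m) measure"
  note 0 [measurable]
  have [measurable]: "L \<in> borel_measurable borel"
    by (rule borel_measurable_linear[OF L])
  interpret G: product_sigma_finite "\<lambda>_::nat. ?G"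
    by (rule product_sigma_finite_const[OF prob_space_std_normal_vec])
  interpret E: prob_space "PiM {} (\<lambda>_::nat. ?G)" by (intro prob_space_PiM_const prob_space_std_normal_vec)
  have "(\<integral>\<^sup>+w. f (\<Sum>i<Suc 0. outer (x i *\<^sub>R p + L (w i))) \<partial>PiM {..<Suc 0} (\<lambda>_. ?G))
      = (\<integral>\<^sup>+y. f (outer (x 0 *\<^sub>R p + L y)) \<partial>?G)"
    by (simp add: lessThan_Suc G.product_nn_integral_insert_rev E.emeasure_space_1)
  also have "\<dots> = (\<integral>\<^sup>+y. f (outer (\<bar>x 0\<bar> *\<^sub>R p + L y)) \<partial>?G)"
  \<comment> \<open>The square root yields \<open>\<bar>x 0\<bar>\<close> instead of
    \<open>x 0\<close>; a negative sign is removed by symmetry of the noise and invariance of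
    \<open>outer\<close> under negation.\<close>
  proof (cases "0 \<le> x 0")
    case False
    have eq: "outer (x 0 *\<^sub>R p + L (- y)) = outer (\<bar>x 0\<bar> *\<^sub>R p + L y)" for y
      using False outer_minus[of "x 0 *\<^sub>R p + L (- y)"] by (simp add: linear_neg[OF L])
    have "(\<integral>\<^sup>+y. f (outer (x 0 *\<^sub>R p + L y)) \<partial>?G) = (\<integral>\<^sup>+y. f (outer (x 0 *\<^sub>R p + L (- y))) \<partial>?G)"
      by (rule nn_integral_std_normal_vec_uminus[symmetric]) measurable
    then show ?thesis by (simp only: eq)
  qed simp
  finally show ?case by (simp add: spiked_gram_def E.emeasure_space_1)
next
  case (Suc r)
  let ?G = "std_normal_vec :: (real^'m) measure" and ?P = "\<lambda>r. PiM {..<r} (\<lambda>_::nat. std_normal_vec :: (real^'m) measure)"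
  note Suc.prems [measurable]
  have [measurable]: "L \<in> borel_measurable borel"
    by (rule borel_measurable_linear[OF L])
  interpret G: prob_space ?G by (rule prob_space_std_normal_vec)
  interpret PG: product_sigma_finite "\<lambda>_::nat. ?G"
    by (rule product_sigma_finite_const[OF prob_space_std_normal_vec])
  interpret P: prob_space "?P r" by (intro prob_space_PiM_const prob_space_std_normal_vec)
  interpret GG: pair_sigma_finite ?G ?G ..
  define q where "q = (\<Sum>i<Suc r. (x i)\<^sup>2)"
  define a where "a = sqrt q"
  define b where "b = x (Suc r)"
  define a' where "a' = sqrt (q + b\<^sup>2)"
  have q: "0 \<le> q" unfolding q_def by (intro sum_nonneg) auto
  have a: "0 \<le> a" "a\<^sup>2 = q" and a': "0 \<le> a'" "a'\<^sup>2 = q + b\<^sup>2" using q by (auto simp: a_def a'_def)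
  \<comment> \<open>Cosine \<open>a / a'\<close> and sine \<open>b / a'\<close>, where
    \<open>a\<close> is the coefficient collected so far and \<open>b\<close> the new one; if
    \<open>a' = 0\<close>, both vanish and the identity rotation serves. The cosine is nonnegative
    because \<open>a\<close> is a square root.\<close>
  obtain c s where cs: "c\<^sup>2 + s\<^sup>2 = 1" "0 \<le> c" "c * a + s * b = a'" "c * b = s * a"
  proof (cases "a' = 0")
    case True
    with a a' q have "a = 0" "b = 0" by (simp_all add: add_nonneg_eq_0_iff)
    with True show thesis by (intro that[of 1 0]) auto
  next
    case False
    have nz: "q + b\<^sup>2 \<noteq> 0" using False a'(2) by (metis zero_eq_power2)
    have "(a / a')\<^sup>2 + (b / a')\<^sup>2 = 1"
      using nz a a' by (simp add: power_divide add_divide_distrib[symmetric])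
    moreover have "a / a' * a + b / a' * b = a'"
      using False a a' by (simp add: add_divide_distrib[symmetric] power2_eq_square[symmetric] divide_eq_eq)
    ultimately show thesis using a a' by (intro that[of "a / a'" "b / a'"]) auto
  qed
  \<comment> \<open>The noise vectors that the rotation leaves alone are integrated out, so that
    rotation invariance can be applied to a function of the pair \<open>(y, z)\<close> only.\<close>
  define g where "g = (\<lambda>(y, z). \<integral>\<^sup>+w. f (spiked_gram (a' *\<^sub>R p) (L y) (\<lambda>i. L ((w(r := z)) i)) (Suc r)) \<partial>?P r)"
  have [measurable]: "g \<in> borel_measurable (borel \<Otimes>\<^sub>M borel)"
    unfolding g_def spiked_gram_def by simp
  have ins: "{..<Suc k} = insert k {..<k}" for k by auto
  have "(\<integral>\<^sup>+w. f (\<Sum>i<Suc (Suc r). outer (x i *\<^sub>R p + L (w i))) \<partial>?P (Suc (Suc r)))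
      = (\<integral>\<^sup>+z. \<integral>\<^sup>+w. f ((\<Sum>i<Suc r. outer (x i *\<^sub>R p + L (w i))) + outer (b *\<^sub>R p + L z)) \<partial>?P (Suc r) \<partial>?G)"
    unfolding ins[of "Suc r"] 
    by (subst PG.product_nn_integral_insert_rev) (auto simp: b_def add.commute intro!: nn_integral_cong arg_cong[where f=f] sum.cong)
  also have "\<dots> = (\<integral>\<^sup>+z. \<integral>\<^sup>+y. \<integral>\<^sup>+w. f (spiked_gram (a *\<^sub>R p) (L y) (\<lambda>i. L (w i)) r + outer (b *\<^sub>R p + L z)) \<partial>?P r \<partial>?G \<partial>?G)"
    unfolding a_def q_def by (intro nn_integral_cong Suc.IH) measurable
  also have "\<dots> = (\<integral>\<^sup>+z. \<integral>\<^sup>+y. g (c *\<^sub>R y + s *\<^sub>R z, c *\<^sub>R z - s *\<^sub>R y) \<partial>?G \<partial>?G)"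
    by (simp add: g_def spiked_gram_add_outer[OF L cs(1,3,4)])
  also have "\<dots> = (\<integral>\<^sup>+y. \<integral>\<^sup>+z. g (c *\<^sub>R y + s *\<^sub>R z, c *\<^sub>R z - s *\<^sub>R y) \<partial>?G \<partial>?G)"
    by (rule GG.Fubini') measurable
  also have "\<dots> = (\<integral>\<^sup>+y. \<integral>\<^sup>+z. g (y, z) \<partial>?G \<partial>?G)"
    by (rule nn_integral_std_normal_vec_rotation[OF _ cs(1,2)]) measurable
  also have "\<dots> = (\<integral>\<^sup>+y. \<integral>\<^sup>+w. f (spiked_gram (a' *\<^sub>R p) (L y) (\<lambda>i. L (w i)) (Suc r)) \<partial>?P (Suc r) \<partial>?G)"
  proof (rule nn_integral_cong)
    fix y :: "real^'m"
    have "(\<lambda>w. f (spiked_gram (a' *\<^sub>R p) (L y) (\<lambda>i. L (w i)) (Suc r))) \<in> borel_measurable (?P (Suc r))"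
      by measurable
    then show "(\<integral>\<^sup>+z. g (y, z) \<partial>?G)
        = (\<integral>\<^sup>+w. f (spiked_gram (a' *\<^sub>R p) (L y) (\<lambda>i. L (w i)) (Suc r)) \<partial>?P (Suc r))"
      unfolding g_def prod.case ins[of r]
      by (intro PG.product_nn_integral_insert_rev[symmetric]) auto
  qed
  also have "a' = sqrt (\<Sum>i<Suc (Suc r). (x i)\<^sup>2)"
    by (simp add: a'_def q_def b_def)
  finally show ?case .
qed

text \<open>Take an orthogonal map \<open>f\<close> with \<open>f (axis k 1) = v\<close> and let
  \<open>L\<close> delete coordinate \<open>k\<close> before applying \<open>f\<close>. The last
  property says that \<open>L\<close> maps standard normal noise to noise with covariance
  \<open>I - v v^T\<close>.\<close>

lemma perp_map_exists:
  fixes v :: "real^'m" and k :: 'm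
  assumes v: "norm v = 1"
  obtains L :: "real^'m \<Rightarrow> real^'m" where "linear L" "\<And>y. L y \<bullet> v = 0"
    "\<And>y z. L y \<bullet> L z = (y - y $ k *\<^sub>R axis k 1) \<bullet> z"
    "\<And>u. \<exists>b. b \<bullet> b = u \<bullet> u - (u \<bullet> v)\<^sup>2 \<and> (\<forall>y. u \<bullet> L y = b \<bullet> y)"
proof -
  obtain f :: "real^'m \<Rightarrow> real^'m" where f: "orthogonal_transformation f" and fv: "f (axis k 1) = v"
    using orthogonal_transformation_exists_1[of "axis k 1" v] v by auto
  have lin: "linear f" and inn: "f y \<bullet> f z = y \<bullet> z" for y z
    using f by (auto simp: orthogonal_transformation_def)
  have iv: "f y \<bullet> v = y $ k" for y
    using inn[of y "axis k 1"] by (simp add: fv inner_axis)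
  then have vi: "v \<bullet> f y = y $ k" for y
    by (simp add: inner_commute)
  have vv: "v \<bullet> v = 1" using v by (simp add: norm_eq_1)
  define L where "L = (\<lambda>y. f y - y $ k *\<^sub>R v)"
  show thesis
  proof
    show "linear L"
      unfolding L_def by (intro linearI) (simp_all add: linear_add[OF lin] linear_cmul[OF lin] algebra_simps)
    show "L y \<bullet> v = 0" for y by (simp add: L_def inner_diff_left iv vv)
    show "L y \<bullet> L z = (y - y $ k *\<^sub>R axis k 1) \<bullet> z" for y z
      by (simp add: L_def inner_diff_left inner_diff_right inn iv vi vv inner_axis')
    show "\<exists>b. b \<bullet> b = u \<bullet> u - (u \<bullet> v)\<^sup>2 \<and> (\<forall>y. u \<bullet> L y = b \<bullet> y)" for u
    proof -
      obtain u' where u: "u = f u'" using orthogonal_transformation_surj[OF f] by (metis surjD)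
      show ?thesis
        \<comment> \<open>The witness \<open>b\<close> is \<open>u\<close> pulled back by
          \<open>f\<close> with coordinate \<open>k\<close> deleted.\<close>
        by (rule exI[of _ "u' - u' $ k *\<^sub>R axis k 1"])
          (simp add: u iv vi L_def inn inner_diff_left inner_diff_right inner_axis inner_axis' power2_eq_square algebra_simps)
    qed
  qed
qed

text \<open>For each \<open>u\<close> the functional is a sum of two independent centered normals
  with variances \<open>(lam + s\<^sup>2) * (u \<bullet> v)\<^sup>2\<close> and
  \<open>s\<^sup>2 * (u \<bullet> u - (u \<bullet> v)\<^sup>2)\<close>; the terms
  \<open>s\<^sup>2 * (u \<bullet> v)\<^sup>2\<close> cancel.\<close>

lemma mv_normal_spiked:
  fixes v :: "real^'m" and L :: "real^'m \<Rightarrow> real^'m"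
  assumes L: "linear L" and Lv: "\<And>u. \<exists>b. b \<bullet> b = u \<bullet> u - (u \<bullet> v)\<^sup>2 \<and> (\<forall>y. u \<bullet> L y = b \<bullet> y)"
    and lam: "0 < lam"
  shows "mv_normal (s\<^sup>2 *\<^sub>R mat 1 + lam *\<^sub>R outer v)
    (distr (std_normal \<Otimes>\<^sub>M std_normal_vec) borel (\<lambda>(x, y). x *\<^sub>R (sqrt (lam + s\<^sup>2) *\<^sub>R v) + s *\<^sub>R L y))"
    (is "mv_normal ?S (distr ?P borel ?f)")
proof -
  have [measurable]: "L \<in> borel_measurable borel"
    by (rule borel_measurable_linear[OF L])
  interpret X: prob_space std_normal by (rule prob_space_std_normal)
  interpret G: prob_space "std_normal_vec :: (real^'m) measure" by (rule prob_space_std_normal_vec)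
  interpret P: pair_prob_space std_normal "std_normal_vec :: (real^'m) measure" ..
  have Su: "u \<bullet> (?S *v u) = s\<^sup>2 * (u \<bullet> u) + lam * (u \<bullet> v)\<^sup>2" for u
    by (simp add: matrix_vector_mult_add_rdistrib scaleR_matrix_vector_assoc[symmetric] outer_mult_vec
        inner_add_right inner_commute[of v] power2_eq_square)
  have "covariance_matrix ?S"
    unfolding covariance_matrix_def Su using lam
    by (auto simp: transpose_add transpose_scalar transpose_outer)
  moreover have "distr (distr ?P borel ?f) borel (\<lambda>z. u \<bullet> z) = centered_normal (u \<bullet> (?S *v u))" for u
  proof -
    obtain b where b: "b \<bullet> b = u \<bullet> u - (u \<bullet> v)\<^sup>2" "\<And>y. u \<bullet> L y = b \<bullet> y" using Lv[of u] by auto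
    let ?t = "sqrt (lam + s\<^sup>2) * (u \<bullet> v)"
    have "distr (distr ?P borel ?f) borel (\<lambda>z. u \<bullet> z) = distr ?P borel (\<lambda>(x, y). ?t * x + (s *\<^sub>R b) \<bullet> y)"
      by (subst distr_distr) (auto intro!: distr_cong simp: comp_def inner_add_right b(2) mult_ac)
    also have "\<dots> = (centered_normal (?t\<^sup>2) \<star> centered_normal ((s *\<^sub>R b) \<bullet> (s *\<^sub>R b)))"
      by (subst distr_pair_sum) (simp_all add: distr_std_normal_mult distr_std_normal_vec_inner G.prob_space_axioms del: inner_scaleR_left inner_scaleR_right)
    also have "\<dots> = centered_normal (?t\<^sup>2 + (s *\<^sub>R b) \<bullet> (s *\<^sub>R b))"
      by (rule convolution_centered_normal) (simp_all only: zero_le_power2 inner_ge_zero)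
    also have "?t\<^sup>2 + (s *\<^sub>R b) \<bullet> (s *\<^sub>R b) = u \<bullet> (?S *v u)"
      unfolding Su using lam by (simp add: b(1) power_mult_distrib add_nonneg_nonneg power2_eq_square[of s] algebra_simps)
    finally show ?thesis .
  qed
  ultimately show ?thesis
    unfolding mv_normal_def by (auto intro!: P.P.prob_space_distr)
qed

text \<open>The sample is split into its spike coefficients \<open>x\<close> and its noise. Given
  \<open>x\<close>, the reduction to a spiked Gram matrix leaves a dependence on the sum of the
  squared coefficients only, and that sum is chi-squared.\<close>

lemma emeasure_distr_gram:
  fixes L :: "real^'m \<Rightarrow> real^'m" and p :: "real^'m"
  assumes L: "linear L" and X: "X \<in> sets borel"
  shows "emeasure (distr (PiM {..<Suc r} (\<lambda>_. distr (std_normal \<Otimes>\<^sub>M std_normal_vec) borel (\<lambda>(x, y). x *\<^sub>R p + L y)))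
      borel (\<lambda>z. \<Sum>i<Suc r. outer (z i))) X
    = (\<integral>\<^sup>+a. \<integral>\<^sup>+y. \<integral>\<^sup>+w. indicator X (spiked_gram (sqrt a *\<^sub>R p) (L y) (\<lambda>i. L (w i)) r)
        \<partial>PiM {..<r} (\<lambda>_. std_normal_vec) \<partial>std_normal_vec \<partial>chi_squared (Suc r))"
proof -
  let ?n = "Suc r" and ?G = "std_normal_vec :: (real^'m) measure"
  let ?f = "\<lambda>(x, y). x *\<^sub>R p + L y"
  let ?P = "std_normal \<Otimes>\<^sub>M ?G" and ?D = "distr (std_normal \<Otimes>\<^sub>M ?G) borel (\<lambda>(x, y). x *\<^sub>R p + L y)"
  let ?PX = "PiM {..<?n} (\<lambda>_. std_normal)" and ?PG = "PiM {..<?n} (\<lambda>_. ?G)"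
  have [measurable]: "L \<in> borel_measurable borel"
    by (rule borel_measurable_linear[OF L])
  note X [measurable]
  interpret X: prob_space std_normal by (rule prob_space_std_normal)
  interpret G: prob_space ?G by (rule prob_space_std_normal_vec)
  interpret P: pair_prob_space std_normal ?G ..
  interpret PG: prob_space ?PG by (intro prob_space_PiM_const prob_space_std_normal_vec)
  interpret PGr: prob_space "PiM {..<r} (\<lambda>_::nat. ?G)" by (intro prob_space_PiM_const prob_space_std_normal_vec)
  have f [measurable]: "?f \<in> measurable ?P borel" by measurable
  have DP: "prob_space ?D" by (intro P.P.prob_space_distr f)
  have c [measurable]: "compose {..<?n} ?f \<in> measurable (PiM {..<?n} (\<lambda>_. ?P)) (PiM {..<?n} (\<lambda>_. borel))"
    unfolding compose_def by measurable
  have "PiM {..<?n} (\<lambda>_. ?D) = distr (PiM {..<?n} (\<lambda>_. ?P)) (PiM {..<?n} (\<lambda>_. ?D)) (compose {..<?n} ?f)"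
  proof -
    have f': "?f \<in> measurable ?P ?D" by simp
    have "distr ?P ?D ?f = ?D" by (rule distr_cong) auto
    then show ?thesis
      using distr_PiM_finite_prob_space'[of "{..<?n}" "\<lambda>_. ?P" "\<lambda>_. ?D" ?f] f' DP P.P.prob_space_axioms
      by simp
  qed
  also have "\<dots> = distr (PiM {..<?n} (\<lambda>_. ?P)) (PiM {..<?n} (\<lambda>_. borel)) (compose {..<?n} ?f)"
    by (intro distr_cong refl sets_PiM_cong) simp_all
  also have "PiM {..<?n} (\<lambda>_. ?P) = distr (?PX \<Otimes>\<^sub>M ?PG) (PiM {..<?n} (\<lambda>_. ?P)) (\<lambda>(x, y). \<lambda>i\<in>{..<?n}. (x i, y i))"
    by (subst distr_PiM_zip) (auto intro: X.prob_space_axioms G.prob_space_axioms)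
  finally have D: "PiM {..<?n} (\<lambda>_. ?D) = distr (distr (?PX \<Otimes>\<^sub>M ?PG) (PiM {..<?n} (\<lambda>_. ?P)) (\<lambda>(x, y). \<lambda>i\<in>{..<?n}. (x i, y i)))
      (PiM {..<?n} (\<lambda>_. borel)) (compose {..<?n} ?f)" .
  define J where "J = (\<lambda>a. \<integral>\<^sup>+y. \<integral>\<^sup>+w. indicator X (spiked_gram (sqrt a *\<^sub>R p) (L y) (\<lambda>i. L (w i)) r)
        \<partial>PiM {..<r} (\<lambda>_. ?G) \<partial>?G)"
  have J [measurable]: "J \<in> borel_measurable borel" unfolding J_def spiked_gram_def by simp
  have "distr (PiM {..<?n} (\<lambda>_. ?D)) borel (\<lambda>z. \<Sum>i<?n. outer (z i))
      = distr (?PX \<Otimes>\<^sub>M ?PG) borel (\<lambda>(x, y). \<Sum>i<?n. outer (x i *\<^sub>R p + L (y i)))"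
    unfolding D
    by (subst distr_distr, measurable, subst distr_distr, measurable)
      (auto intro!: distr_cong sum.cong simp: comp_def compose_def)
  then have "emeasure (distr (PiM {..<?n} (\<lambda>_. ?D)) borel (\<lambda>z. \<Sum>i<?n. outer (z i))) X
      = (\<integral>\<^sup>+q. indicator X (case q of (x, y) \<Rightarrow> \<Sum>i<?n. outer (x i *\<^sub>R p + L (y i))) \<partial>(?PX \<Otimes>\<^sub>M ?PG))"
    by (simp only:) (subst emeasure_distr_nn_integral, auto)
  also have "\<dots> = (\<integral>\<^sup>+x. \<integral>\<^sup>+y. indicator X (\<Sum>i<?n. outer (x i *\<^sub>R p + L (y i))) \<partial>?PG \<partial>?PX)"
    by (subst PG.nn_integral_fst[symmetric]) auto
  also have "\<dots> = (\<integral>\<^sup>+x. J (\<Sum>i<?n. (x i)\<^sup>2) \<partial>?PX)"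
    unfolding J_def by (intro nn_integral_cong nn_integral_gram_eq_spiked_gram L) measurable
  also have "\<dots> = (\<integral>\<^sup>+a. J a \<partial>chi_squared ?n)"
    unfolding chi_squared_def by (subst nn_integral_distr) auto
  finally show ?thesis unfolding J_def .
qed

subsection \<open>Realization on one probability space\<close>

text \<open>Almost sure convergence implies convergence in probability. Passing from the right-hand
  limit to arbitrary sequences makes dominated convergence applicable to the indicators of the
  exceptional sets.\<close>

lemma small_o_p_AE_tendsto:
  fixes R :: "real \<Rightarrow> 'w \<Rightarrow> real"
  assumes M: "prob_space M" and R: "\<And>t. 0 < t \<Longrightarrow> R t \<in> borel_measurable M"
    and lim: "AE \<omega> in M. ((\<lambda>t. R t \<omega> / a t) \<longlongrightarrow> 0) (at_right 0)"
  shows "small_o_p (\<lambda>_. M) R a (at_right 0)"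
  unfolding small_o_p_def
proof (intro conjI allI impI)
  interpret prob_space M by fact
  show "\<forall>\<^sub>F t in at_right 0. prob_space M \<and> R t \<in> borel_measurable M"
    using R M eventually_at_right_less[of "0::real"] by (auto elim: eventually_mono)
  fix e :: real assume e: "0 < e"
  show "((\<lambda>t. measure M {\<omega> \<in> space M. e < \<bar>R t \<omega> / a t\<bar>}) \<longlongrightarrow> 0) (at_right 0)"
  proof (rule tendsto_at_right_sequentially[of 0 1])
    fix S :: "nat \<Rightarrow> real" assume S: "\<And>n. 0 < S n" "S \<longlonglongrightarrow> 0"
    define B where "B = (\<lambda>n. {\<omega> \<in> space M. e < \<bar>R (S n) \<omega> / a (S n)\<bar>})"
    have [measurable]: "R (S n) \<in> borel_measurable M" for n using R S by auto
    have B [measurable]: "B n \<in> sets M" for n unfolding B_def by measurable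
    have S0: "filterlim S (at_right 0) sequentially"
    proof -
      have "S n \<in> {0<..} \<and> S n \<noteq> 0" for n using S(1)[of n] by simp
      with S(2) show ?thesis by (simp add: filterlim_at)
    qed
    have "(\<lambda>n. \<integral>\<omega>. indicator (B n) \<omega> \<partial>M) \<longlonglongrightarrow> (\<integral>\<omega>. (0::real) \<partial>M)"
    proof (rule integral_dominated_convergence[where w="\<lambda>_. 1"])
      show "AE \<omega> in M. (\<lambda>n. indicator (B n) \<omega> :: real) \<longlonglongrightarrow> 0"
        using lim
      proof eventually_elim
        case (elim \<omega>)
        have "(\<lambda>n. R (S n) \<omega> / a (S n)) \<longlonglongrightarrow> 0"
          by (rule filterlim_compose[OF elim S0])
        then have "\<forall>\<^sub>F n in sequentially. \<bar>R (S n) \<omega> / a (S n)\<bar> < e"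
          using e by (auto dest!: tendstoD)
        then have "\<forall>\<^sub>F n in sequentially. indicator (B n) \<omega> = (0::real)"
          by eventually_elim (auto simp: B_def)
        then show ?case by (rule tendsto_eventually)
      qed
    qed auto
    then have "(\<lambda>n. measure M (B n)) \<longlonglongrightarrow> 0"
      using B by simp
    then show "(\<lambda>n. measure M {\<omega> \<in> space M. e < \<bar>R (S n) \<omega> / a (S n)\<bar>}) \<longlonglongrightarrow> 0"
      unfolding B_def .
  qed simp
qed

text \<open>Setting two of the three sets to \<open>UNIV\<close> in the product formula yields the
  marginals; the formula on boxes then identifies the joint law as their product measure, which is
  independence.\<close>

lemma (in prob_space) indep_vars_three:
  fixes A B C :: "'a \<Rightarrow> real"
  assumes [measurable]: "A \<in> borel_measurable M" "B \<in> borel_measurable M" "C \<in> borel_measurable M"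
    and D: "prob_space D0" "prob_space D1" "prob_space D2"
    and S: "sets D0 = sets borel" "sets D1 = sets borel" "sets D2 = sets borel"
    and eq: "\<And>E0 E1 E2. E0 \<in> sets borel \<Longrightarrow> E1 \<in> sets borel \<Longrightarrow> E2 \<in> sets borel \<Longrightarrow>
      emeasure M {x \<in> space M. A x \<in> E0 \<and> B x \<in> E1 \<and> C x \<in> E2} = emeasure D0 E0 * (emeasure D1 E1 * emeasure D2 E2)"
  shows "distr M borel A = D0" "distr M borel B = D1" "distr M borel C = D2"
    and "indep_vars (\<lambda>_. borel) (\<lambda>i. [A, B, C] ! i) {..<3}"
proof -
  have one: "emeasure D0 UNIV = 1" "emeasure D1 UNIV = 1" "emeasure D2 UNIV = 1"
    using D[THEN prob_space.emeasure_space_1] S[THEN sets_eq_imp_space_eq] by simp_all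
  show dA: "distr M borel A = D0" and dB: "distr M borel B = D1" and dC: "distr M borel C = D2"
    using eq[of _ UNIV UNIV] eq[of UNIV _ UNIV] eq[of UNIV UNIV]
    by (auto intro!: measure_eqI simp: S one emeasure_distr vimage_def Int_def conj_commute)
  let ?D = "\<lambda>i::nat. if i = 0 then D0 else if i = 1 then D1 else D2"
  interpret PD: product_sigma_finite ?D
    unfolding product_sigma_finite_def using D by (simp add: prob_space_imp_sigma_finite)
  have three: "{..<3} = {0, 1, 2::nat}" by auto
  have rv: "[A, B, C] ! i \<in> borel_measurable M" if "i \<in> {..<3}" for i
    using that by (auto simp: three)
  have m: "(\<lambda>x. \<lambda>i\<in>{..<3}. ([A, B, C] ! i) x) \<in> measurable M (PiM {..<3} (\<lambda>_. borel))"
    by (intro measurable_restrict rv)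
  have "distr M (PiM {..<3} (\<lambda>_. borel)) (\<lambda>x. \<lambda>i\<in>{..<3}. ([A, B, C] ! i) x) = PiM {..<3} ?D"
  proof (rule PD.PiM_eqI)
    show "sets (distr M (PiM {..<3} (\<lambda>_. borel)) (\<lambda>x. \<lambda>i\<in>{..<3}. ([A, B, C] ! i) x)) = sets (PiM {..<3} ?D)"
      unfolding sets_distr by (intro sets_PiM_cong refl) (simp add: S)
    fix E assume "\<And>i. i \<in> {..<3} \<Longrightarrow> E i \<in> sets (?D i)"
    from this[of 0] this[of 1] this[of 2] have E: "E 0 \<in> sets borel" "E 1 \<in> sets borel" "E 2 \<in> sets borel"
      by (simp_all add: S)
    have "Pi\<^sub>E {..<3} E \<in> sets (PiM {..<3} (\<lambda>_. borel))"
      using E by (intro sets_PiM_I_finite) (auto simp: three)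
    then have "emeasure (distr M (PiM {..<3} (\<lambda>_. borel)) (\<lambda>x. \<lambda>i\<in>{..<3}. ([A, B, C] ! i) x)) (Pi\<^sub>E {..<3} E)
        = emeasure M {x \<in> space M. A x \<in> E 0 \<and> B x \<in> E 1 \<and> C x \<in> E 2}"
      using m by (subst emeasure_distr) (auto intro!: arg_cong[where f="emeasure M"] simp: three PiE_iff)
    also have "\<dots> = (\<Prod>i<3. emeasure (?D i) (E i))"
      by (subst eq[OF E]) (simp add: three)
    finally show "emeasure (distr M (PiM {..<3} (\<lambda>_. borel)) (\<lambda>x. \<lambda>i\<in>{..<3}. ([A, B, C] ! i) x)) (Pi\<^sub>E {..<3} E)
        = (\<Prod>i<3. emeasure (?D i) (E i))" .
  qed simp
  also have "\<dots> = PiM {..<3} (\<lambda>i. distr M borel ([A, B, C] ! i))"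
    by (rule PiM_cong) (auto simp: three dA dB dC)
  finally show "indep_vars (\<lambda>_. borel) (\<lambda>i. [A, B, C] ! i) {..<3}"
    by (intro indep_vars_iff_distr_eq_PiM'[THEN iffD2] rv) (simp_all add: three)
qed

section \<open>The product space of the three ingredients and its encoding\<close>

lemma nn_integral_pair3:
  assumes N: "prob_space N" and K: "prob_space K" and g: "g \<in> borel_measurable (M \<Otimes>\<^sub>M (N \<Otimes>\<^sub>M K))"
  shows "(\<integral>\<^sup>+x. g x \<partial>(M \<Otimes>\<^sub>M (N \<Otimes>\<^sub>M K))) = (\<integral>\<^sup>+a. \<integral>\<^sup>+y. \<integral>\<^sup>+w. g (a, y, w) \<partial>K \<partial>N \<partial>M)"
proof -
  interpret N: prob_space N by fact
  interpret K: prob_space K by fact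
  interpret NK: pair_prob_space N K ..
  have "(\<integral>\<^sup>+x. g x \<partial>(M \<Otimes>\<^sub>M (N \<Otimes>\<^sub>M K))) = (\<integral>\<^sup>+a. \<integral>\<^sup>+p. g (a, p) \<partial>(N \<Otimes>\<^sub>M K) \<partial>M)"
    by (rule NK.P.nn_integral_fst[OF g, symmetric])
  also have "\<dots> = (\<integral>\<^sup>+a. \<integral>\<^sup>+y. \<integral>\<^sup>+w. g (a, y, w) \<partial>K \<partial>N \<partial>M)"
  proof (rule nn_integral_cong)
    fix a assume "a \<in> space M"
    then have "(\<lambda>p. g (a, p)) \<in> borel_measurable (N \<Otimes>\<^sub>M K)"
      by (rule measurable_compose[OF measurable_Pair1' g])
    from K.nn_integral_fst[OF this]
    show "(\<integral>\<^sup>+p. g (a, p) \<partial>(N \<Otimes>\<^sub>M K)) = (\<integral>\<^sup>+y. \<integral>\<^sup>+w. g (a, y, w) \<partial>K \<partial>N)" ..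
  qed
  finally show ?thesis .
qed

text \<open>For fixed \<open>y\<close> the innermost integral is a chi-squared probability, the same
  for every unit vector \<open>d y\<close>. It therefore leaves the integral over \<open>y\<close>
  as a constant and the whole factors.\<close>

lemma emeasure_chi_squared_joint:
  fixes d :: "real^'m \<Rightarrow> real^'m" and b :: "real^'m \<Rightarrow> real" and n r :: nat
  assumes [measurable]: "d \<in> borel_measurable borel" "b \<in> borel_measurable borel"
      "E0 \<in> sets borel" "E1 \<in> sets borel" "E2 \<in> sets borel"
    and d: "\<And>y. d y \<bullet> d y = 1"
  defines "W \<equiv> chi_squared n \<Otimes>\<^sub>M (std_normal_vec \<Otimes>\<^sub>M PiM {..<r} (\<lambda>_. std_normal_vec))"
  shows "emeasure W {x \<in> space W. fst x \<in> E0 \<and> b (fst (snd x)) \<in> E1 \<and> (\<Sum>i<r. (d (fst (snd x)) \<bullet> snd (snd x) i)\<^sup>2) \<in> E2}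
    = emeasure (chi_squared n) E0 * (emeasure (distr std_normal_vec borel b) E1 * emeasure (chi_squared r) E2)"
proof -
  let ?G = "std_normal_vec :: (real^'m) measure" and ?P = "PiM {..<r} (\<lambda>_. std_normal_vec :: (real^'m) measure)"
  interpret G: prob_space ?G by (rule prob_space_std_normal_vec)
  interpret P: prob_space ?P by (intro prob_space_PiM_const prob_space_std_normal_vec)
  have C: "(\<integral>\<^sup>+w. indicator E2 (\<Sum>i<r. (d y \<bullet> w i)\<^sup>2) \<partial>?P) = emeasure (chi_squared r) E2" for y
    by (subst distr_PiM_std_normal_vec_chi_squared[OF d[of y], symmetric], subst emeasure_distr_nn_integral) auto
  have "emeasure W {x \<in> space W. fst x \<in> E0 \<and> b (fst (snd x)) \<in> E1 \<and> (\<Sum>i<r. (d (fst (snd x)) \<bullet> snd (snd x) i)\<^sup>2) \<in> E2}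
      = (\<integral>\<^sup>+x. indicator E0 (fst x) * (indicator E1 (b (fst (snd x))) * indicator E2 (\<Sum>i<r. (d (fst (snd x)) \<bullet> snd (snd x) i)\<^sup>2)) \<partial>W)"
    unfolding W_def
    by (subst nn_integral_indicator[symmetric], measurable, intro nn_integral_cong) (auto simp: indicator_def)
  also have "\<dots> = (\<integral>\<^sup>+a. \<integral>\<^sup>+y. \<integral>\<^sup>+w. indicator E0 a * (indicator E1 (b y) * indicator E2 (\<Sum>i<r. (d y \<bullet> w i)\<^sup>2)) \<partial>?P \<partial>?G \<partial>chi_squared n)"
    unfolding W_def
    by (subst nn_integral_pair3[OF G.prob_space_axioms P.prob_space_axioms]) simp_all
  also have "\<dots> = (\<integral>\<^sup>+a. \<integral>\<^sup>+y. indicator E0 a * (indicator E1 (b y) * emeasure (chi_squared r) E2) \<partial>?G \<partial>chi_squared n)"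
    by (simp add: nn_integral_cmult C)
  also have "\<dots> = emeasure (chi_squared n) E0 * (emeasure (distr ?G borel b) E1 * emeasure (chi_squared r) E2)"
    by (simp add: nn_integral_cmult nn_integral_multc emeasure_distr_nn_integral)
  finally show ?thesis .
qed

text \<open>The theorem asks for a sample space of sequences of vectors, so the triple of a scalar,
  a vector and \<open>r\<close> vectors is packed into such a sequence and decoded by a left
  inverse.\<close>

lemma encode_as_sequence:
  fixes D :: "real measure" and G :: "(real^'m) measure" and r :: nat
  assumes D: "prob_space D" "sets D = sets borel" and G: "prob_space G" "sets G = sets borel"
  defines "W \<equiv> D \<Otimes>\<^sub>M (G \<Otimes>\<^sub>M PiM {..<r} (\<lambda>_. G))"
  obtains M :: "(nat \<Rightarrow> real^'m) measure" and \<psi>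
    where "prob_space M" "\<psi> \<in> measurable M W" "distr M W \<psi> = W"
proof -
  note [measurable_cong] = D(2) G(2)
  define k :: 'm where "k = undefined"
  interpret D: prob_space D by fact
  interpret G: prob_space G by fact
  interpret P: prob_space "PiM {..<r} (\<lambda>_. G)" by (intro prob_space_PiM_const G)
  interpret GP: pair_prob_space G "PiM {..<r} (\<lambda>_. G)" ..
  interpret W: pair_prob_space D "G \<Otimes>\<^sub>M PiM {..<r} (\<lambda>_. G)" ..
  define \<phi> :: "real \<times> (real^'m) \<times> (nat \<Rightarrow> real^'m) \<Rightarrow> nat \<Rightarrow> real^'m" where
    "\<phi> = (\<lambda>x i. if i < r then snd (snd x) i else if i = r then fst (snd x) else fst x *\<^sub>R axis k 1)"
  \<comment> \<open>The noise occupies the first \<open>r\<close> places, the carrier place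
    \<open>r\<close>, and the scalar is coordinate \<open>k\<close> of place \<open>Suc r\<close>.
    The restriction returns an extensional function, as the points of the product space are.\<close>
  define \<psi> :: "(nat \<Rightarrow> real^'m) \<Rightarrow> real \<times> (real^'m) \<times> (nat \<Rightarrow> real^'m)" where
    "\<psi> = (\<lambda>z. (z (Suc r) $ k, z r, \<lambda>i\<in>{..<r}. z i))"
  let ?S = "PiM UNIV (\<lambda>_::nat. borel :: (real^'m) measure)"
  have phi: "\<phi> \<in> measurable W ?S"
    unfolding \<phi>_def W_def
  proof (rule measurable_abs_UNIV)
    fix i show "(\<lambda>x. if i < r then snd (snd x) i else if i = r then fst (snd x) else fst x *\<^sub>R axis k 1)
        \<in> borel_measurable (D \<Otimes>\<^sub>M (G \<Otimes>\<^sub>M PiM {..<r} (\<lambda>_. G)))"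
      by (cases "i < r"; cases "i = r") simp_all
  qed
  have psi: "\<psi> \<in> measurable ?S W"
    unfolding \<psi>_def W_def
  proof (intro measurable_Pair measurable_restrict)
    have "(\<lambda>z. z (Suc r)) \<in> borel_measurable ?S" by measurable
    then show "(\<lambda>z. z (Suc r) $ k) \<in> measurable ?S D"
      by (simp add: borel_measurable_vec_nth_iff measurable_cong_sets[OF refl D(2)])
  qed measurable
  have inv: "\<psi> (\<phi> x) = x" if "x \<in> space W" for x
    using that by (cases x) (auto simp: W_def \<phi>_def \<psi>_def space_pair_measure space_PiM PiE_iff extensional_def fun_eq_iff)
  show thesis
  proof
    show "prob_space (distr W ?S \<phi>)"
      unfolding W_def by (rule W.P.prob_space_distr) (use phi in \<open>simp add: W_def\<close>)
    show "\<psi> \<in> measurable (distr W ?S \<phi>) W" using psi by simp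
    have "distr (distr W ?S \<phi>) W \<psi> = distr W W (\<psi> \<circ> \<phi>)"
      by (rule distr_distr[OF psi phi])
    also have "\<dots> = distr W W (\<lambda>x. x)"
      by (rule distr_cong) (simp_all add: inv)
    finally show "distr (distr W ?S \<phi>) W \<psi> = W" by simp
  qed
qed

theorem proposition1:
  fixes v :: "real^'m" and n\<^sub>H :: nat and lam\<^sub>H :: real
  assumes "norm v = 1" and "n\<^sub>H \<ge> 1" and "lam\<^sub>H > 0"
  shows "\<exists>(M :: real \<Rightarrow> (nat \<Rightarrow> real^'m) measure) (H :: real \<Rightarrow> (nat \<Rightarrow> real^'m) \<Rightarrow> real^'m^'m) A B C R.
    (\<forall>\<sigma>>0.
      prob_space (M \<sigma>) \<and>
      H \<sigma> \<in> borel_measurable (M \<sigma>) \<and>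
      wishart n\<^sub>H (\<sigma>\<^sup>2 *\<^sub>R mat 1 + lam\<^sub>H *\<^sub>R outer v) (distr (M \<sigma>) borel (H \<sigma>)) \<and>
      prob_space.indep_vars (M \<sigma>) (\<lambda>_. borel) (\<lambda>i. [A \<sigma>, B \<sigma>, C \<sigma>] ! i) {..<3} \<and>
      distr (M \<sigma>) borel (A \<sigma>) = chi_squared n\<^sub>H \<and>
      distr (M \<sigma>) borel (B \<sigma>) = chi_squared (CARD('m) - 1) \<and>
      distr (M \<sigma>) borel (C \<sigma>) = chi_squared (n\<^sub>H - 1) \<and>
      R \<sigma> \<in> borel_measurable (M \<sigma>) \<and>
      (\<forall>\<omega>\<in>space (M \<sigma>).
        largest_eigenvalue (H \<sigma> \<omega>) =
          (lam\<^sub>H + \<sigma>\<^sup>2) * A \<sigma> \<omega> + B \<sigma> \<omega> * \<sigma>\<^sup>2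
          + B \<sigma> \<omega> * C \<sigma> \<omega> / ((lam\<^sub>H + \<sigma>\<^sup>2) * A \<sigma> \<omega>) * \<sigma>^4 + R \<sigma> \<omega>)) \<and>
    small_o_p M R (\<lambda>\<sigma>. \<sigma>^4) (at_right 0)"
proof -
  \<comment> \<open>One sample vector will carry the spike, which leaves
    \<open>r = n\<^sub>H - 1\<close> pure noise vectors. The coordinate \<open>k\<close> fixed next
    is arbitrary.\<close>
  obtain r where n: "n\<^sub>H = Suc r" using assms(2) by (cases n\<^sub>H) auto
  define k :: 'm where "k = undefined"
  obtain L :: "real^'m \<Rightarrow> real^'m" where L: "linear L" and Lv: "\<And>y. L y \<bullet> v = 0"
    and LL: "\<And>y z. L y \<bullet> L z = (y - y $ k *\<^sub>R axis k 1) \<bullet> z"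
    and Lu: "\<And>u. \<exists>b. b \<bullet> b = u \<bullet> u - (u \<bullet> v)\<^sup>2 \<and> (\<forall>y. u \<bullet> L y = b \<bullet> y)"
    using perp_map_exists[OF assms(1), of k] by blast
  have L_meas [measurable]: "L \<in> borel_measurable borel"
    by (rule borel_measurable_linear[OF L])
  let ?G = "std_normal_vec :: (real^'m) measure"
  let ?P = "PiM {..<r} (\<lambda>_. ?G)"
  let ?W = "chi_squared (Suc r) \<Otimes>\<^sub>M (?G \<Otimes>\<^sub>M ?P)"
  define \<pi> where "\<pi> = (\<lambda>y::real^'m. y - y $ k *\<^sub>R axis k 1)"
  \<comment> \<open>If \<open>\<pi> y = 0\<close> (always for \<open>m = 1\<close>) then \<open>B = 0\<close>; \<open>C\<close> then uses the coordinate ignored by \<open>L\<close>.\<close>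
  define d where "d = (\<lambda>y. if \<pi> y = 0 then axis k 1 else \<pi> y /\<^sub>R norm (\<pi> y))"
  define b where "b = (\<lambda>y. L y \<bullet> L y)"
  have nth [measurable]: "(\<lambda>y::real^'m. y $ k) \<in> borel_measurable borel"
    by (intro borel_measurable_continuous_onI continuous_intros)
  have [measurable]: "\<pi> \<in> borel_measurable borel" unfolding \<pi>_def by measurable
  have d_meas [measurable]: "d \<in> borel_measurable borel" unfolding d_def by measurable
  have b_meas [measurable]: "b \<in> borel_measurable borel" unfolding b_def by measurable
  have d1: "d y \<bullet> d y = 1" for y
    by (auto simp: d_def inner_axis power2_norm_eq_inner[symmetric] power2_eq_square divide_simps dot_square_norm)
  have b\<pi>: "b y = (norm (\<pi> y))\<^sup>2" for y
    unfolding b_def LL by (simp add: \<pi>_def power2_norm_eq_inner inner_diff_left inner_diff_right inner_axis inner_axis')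
  \<comment> \<open>This is the relation \<open>BC\<close> of the asymptotic lemma. It holds also
    where \<open>\<pi> y = 0\<close>, since \<open>L y = 0\<close> there and both sides
    vanish.\<close>
  have bd: "b y * (\<Sum>i<r. (d y \<bullet> w i)\<^sup>2) = (\<Sum>i<r. (L (w i) \<bullet> L y)\<^sup>2)" for y and w :: "nat \<Rightarrow> real^'m"
  proof -
    have "L z \<bullet> L y = norm (\<pi> y) * (d y \<bullet> z)" for z
    proof -
      have "L y \<bullet> L z = \<pi> y \<bullet> z" using LL[of y z] by (simp add: \<pi>_def)
      then show ?thesis by (auto simp: d_def inner_commute[of "L z"])
    qed
    then show ?thesis by (simp add: b\<pi> power_mult_distrib sum_distrib_left)
  qed
  have b_law: "distr ?G borel b = chi_squared (CARD('m) - 1)"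
  proof -
    have "b = (\<lambda>y. \<Sum>j\<in>UNIV - {k}. (y $ j)\<^sup>2)"
      by (rule ext, unfold b_def LL)
        (simp add: inner_vec_def axis_def power2_eq_square sum.remove[of UNIV k] cong: sum.cong_simp)
    then show ?thesis using distr_std_normal_vec_chi_squared[of "UNIV - {k}"] by simp
  qed
  \<comment> \<open>One space, and with it \<open>A\<close>, \<open>B\<close>, \<open>C\<close>,
    serves all \<sigma>; only \<open>H\<close> and the remainder vary. Almost sure convergence at
    fixed sample points thus makes sense.\<close>
  obtain M :: "(nat \<Rightarrow> real^'m) measure" and \<psi> where M: "prob_space M"
    and \<psi> [measurable]: "\<psi> \<in> measurable M ?W" and \<psi>_law: "distr M ?W \<psi> = ?W"
    using encode_as_sequence[OF prob_space_chi_squared sets_chi_squared prob_space_std_normal_vec sets_std_normal_vec, of "Suc r" r] by blast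
  interpret M: prob_space M by fact
  interpret P: prob_space ?P by (intro prob_space_PiM_const prob_space_std_normal_vec)
  interpret G: prob_space ?G by (rule prob_space_std_normal_vec)
  define A where "A = (\<lambda>\<omega>. fst (\<psi> \<omega>))"
  define B where "B = (\<lambda>\<omega>. b (fst (snd (\<psi> \<omega>))))"
  define C where "C = (\<lambda>\<omega>. \<Sum>i<r. (d (fst (snd (\<psi> \<omega>))) \<bullet> snd (snd (\<psi> \<omega>)) i)\<^sup>2)"
  define H0 where "H0 = (\<lambda>\<sigma> (a, y, w). spiked_gram (sqrt a *\<^sub>R (sqrt (lam\<^sub>H + \<sigma>\<^sup>2) *\<^sub>R v)) (\<sigma> *\<^sub>R L y) (\<lambda>i. \<sigma> *\<^sub>R L (w i)) r)"
  define H where "H = (\<lambda>\<sigma> \<omega>. H0 \<sigma> (\<psi> \<omega>))"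
  \<comment> \<open>Defined as the exact difference, so that the equation holds at every sample
    point; all the content lies in the estimate of \<open>R\<close>.\<close>
  define R where "R = (\<lambda>\<sigma> \<omega>. largest_eigenvalue (H \<sigma> \<omega>) - ((lam\<^sub>H + \<sigma>\<^sup>2) * A \<omega> + B \<omega> * \<sigma>\<^sup>2
          + B \<omega> * C \<omega> / ((lam\<^sub>H + \<sigma>\<^sup>2) * A \<omega>) * \<sigma>^4))"
  have ABC [measurable]: "A \<in> borel_measurable M" "B \<in> borel_measurable M" "C \<in> borel_measurable M"
    unfolding A_def B_def C_def by (rule measurable_compose[OF \<psi>], measurable)+
  have H0 [measurable]: "H0 \<sigma> \<in> borel_measurable ?W" for \<sigma>
    unfolding H0_def spiked_gram_def by measurable
  have H [measurable]: "H \<sigma> \<in> borel_measurable M" for \<sigma>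
    unfolding H_def by (rule measurable_compose[OF \<psi> H0])
  have R [measurable]: "R \<sigma> \<in> borel_measurable M" for \<sigma>
  proof -
    have "(\<lambda>\<omega>. largest_eigenvalue (H \<sigma> \<omega>)) \<in> borel_measurable M"
      by (rule borel_measurable_largest_eigenvalue[OF H])
        (simp add: H_def H0_def transpose_spiked_gram split: prod.split)
    then show ?thesis unfolding R_def by measurable
  qed
  have joint: "emeasure M {\<omega> \<in> space M. A \<omega> \<in> E0 \<and> B \<omega> \<in> E1 \<and> C \<omega> \<in> E2}
      = emeasure (chi_squared (Suc r)) E0 * (emeasure (chi_squared (CARD('m) - 1)) E1 * emeasure (chi_squared r) E2)"
    if [measurable]: "E0 \<in> sets borel" "E1 \<in> sets borel" "E2 \<in> sets borel" for E0 E1 E2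
  proof -
    let ?E = "{x \<in> space ?W. fst x \<in> E0 \<and> b (fst (snd x)) \<in> E1 \<and> (\<Sum>i<r. (d (fst (snd x)) \<bullet> snd (snd x) i)\<^sup>2) \<in> E2}"
    have "?E \<in> sets ?W" by measurable
    then have "emeasure (distr M ?W \<psi>) ?E = emeasure M (\<psi> -` ?E \<inter> space M)"
      by (intro emeasure_distr \<psi>)
    also have "\<psi> -` ?E \<inter> space M = {\<omega> \<in> space M. A \<omega> \<in> E0 \<and> B \<omega> \<in> E1 \<and> C \<omega> \<in> E2}"
      using measurable_space[OF \<psi>] by (auto simp: A_def B_def C_def)
    finally show ?thesis
      unfolding \<psi>_law using emeasure_chi_squared_joint[OF d_meas b_meas that d1, of "Suc r" r] by (simp add: b_law)
  qed
  note indep_vars_ABC = M.indep_vars_three[OF ABC prob_space_chi_squared prob_space_chi_squared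
      prob_space_chi_squared sets_chi_squared sets_chi_squared sets_chi_squared]
  have laws: "distr M borel A = chi_squared (Suc r)" "distr M borel B = chi_squared (CARD('m) - 1)"
      "distr M borel C = chi_squared r" "M.indep_vars (\<lambda>_. borel) (\<lambda>i. [A, B, C] ! i) {..<3}"
    by (rule indep_vars_ABC; rule joint; assumption)+
  \<comment> \<open>The Gram computation is applied with the spike vector \<open>?p\<close> and with
    \<open>L\<close> scaled by \<sigma>, which turns its mixture of integrals into the law of
    \<open>H0\<close> under \<open>?W\<close>.\<close>
  have wishart: "wishart (Suc r) (\<sigma>\<^sup>2 *\<^sub>R mat 1 + lam\<^sub>H *\<^sub>R outer v) (distr M borel (H \<sigma>))" for \<sigma>
  proof -
    let ?p = "sqrt (lam\<^sub>H + \<sigma>\<^sup>2) *\<^sub>R v" and ?L = "\<lambda>y. \<sigma> *\<^sub>R L y"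
    let ?N = "distr (std_normal \<Otimes>\<^sub>M ?G) borel (\<lambda>(x, y). x *\<^sub>R ?p + ?L y)"
    have "distr M borel (H \<sigma>) = distr (PiM {..<Suc r} (\<lambda>_. ?N)) borel (\<lambda>z. \<Sum>i<Suc r. outer (z i))"
    proof (rule measure_eqI)
      fix X assume "X \<in> sets (distr M borel (H \<sigma>))"
      then have X [measurable]: "X \<in> sets borel" by simp
      have "emeasure (distr M borel (H \<sigma>)) X = emeasure (distr (distr M ?W \<psi>) borel (H0 \<sigma>)) X"
        by (subst distr_distr) (auto simp: comp_def H_def)
      also have "\<dots> = (\<integral>\<^sup>+x. indicator X (H0 \<sigma> x) \<partial>?W)"
        unfolding \<psi>_law by (subst emeasure_distr_nn_integral) auto
      also have "\<dots> = (\<integral>\<^sup>+a. \<integral>\<^sup>+y. \<integral>\<^sup>+w. indicator X (H0 \<sigma> (a, y, w)) \<partial>?P \<partial>?G \<partial>chi_squared (Suc r))"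
        by (rule nn_integral_pair3[OF G.prob_space_axioms P.prob_space_axioms]) measurable
      also have "\<dots> = emeasure (distr (PiM {..<Suc r} (\<lambda>_. ?N)) borel (\<lambda>z. \<Sum>i<Suc r. outer (z i))) X"
        by (subst emeasure_distr_gram[OF linear_compose_scale_right[OF L] X]) (simp add: H0_def)
      finally show "emeasure (distr M borel (H \<sigma>)) X
          = emeasure (distr (PiM {..<Suc r} (\<lambda>_. ?N)) borel (\<lambda>z. \<Sum>i<Suc r. outer (z i))) X" .
    qed simp
    with mv_normal_spiked[OF L Lu assms(3)] show ?thesis unfolding wishart_def by blast
  qed
  have "AE a in distr M borel A. 0 < a"
    unfolding laws(1) by (rule AE_chi_squared_pos)
  then have "AE \<omega> in M. 0 < A \<omega>"
    by (rule AE_distrD[rotated]) measurable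
  \<comment> \<open>At each sample point with \<open>A \<omega> > 0\<close> the deterministic
    asymptotics apply with \<open>u = L y\<close> and noise vectors \<open>L (w i)\<close>.\<close>
  then have "AE \<omega> in M. ((\<lambda>\<sigma>. R \<sigma> \<omega> / \<sigma>^4) \<longlongrightarrow> 0) (at_right 0)"
  proof eventually_elim
    case (elim \<omega>)
    obtain a y w where \<omega>: "\<psi> \<omega> = (a, y, w)" by (cases "\<psi> \<omega>") auto
    have "L y \<bullet> L y * C \<omega> = (\<Sum>i<r. (L (w i) \<bullet> L y)\<^sup>2)"
      using bd[of y w] by (simp add: C_def \<omega> b_def)
    from spiked_gram_asymptotics[OF assms(1) Lv Lv _ assms(3) this, of a] elim show ?case
      by (simp add: R_def H_def H0_def A_def B_def \<omega> b_def)
  qed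
  then have "small_o_p (\<lambda>_. M) R (\<lambda>\<sigma>. \<sigma>^4) (at_right 0)"
    by (intro small_o_p_AE_tendsto M R)
  then show ?thesis
    using M H wishart laws R
    by (intro exI[of _ "\<lambda>_. M"] exI[of _ H] exI[of _ "\<lambda>_. A"] exI[of _ "\<lambda>_. B"] exI[of _ "\<lambda>_. C"] exI[of _ R])
      (simp add: n R_def)
qed

end
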